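(* Let $N\in\mathbb{N}_{\ge 1}$. Let $X_0,\dots,X_N$ (state spaces), $U_0,\dots,U_{N-1}$ (input spaces) and $R_0,\dots,R_N$ (reference spaces) be Polish spaces, and let $f_k:X_k\times U_k\to X_{k+1}$, $g_k:X_k\times U_k\to[0,+\infty]$ ($k=0,\dots,N-1$; the stage costs do not depend on the reference) and $g_N:X_N\times R_N\to[0,+\infty]$ be Borel maps. Let $J$ be the value of the optimal control problem in probability spaces, $J_k$ the cost-to-go of the dynamic programming algorithm in probability spaces, and $j_k$ the cost-to-go of the dynamic programming algorithm in the ground space, all as defined in the context. Then the following hold. (i) For every $k\in\{0,\dots,N\}$, every $\mu_k\in\mathcal{P}(X_k)$ and every $\rho_N\in\mathcal{P}(R_N)$, $$J_k(\mu_k,\rho_N)=\mathcal{K}[j_k](\mu_k,\rho_N)=\inf_{\gamma\in\Gamma(\mu_k,\rho_N)}\int_{X_k\times R_N} j_k(x_k,r_N)\,d\gamma(x_k,r_N).$$ Moreover, the dynamic programming algorithm yields the optimal value: $J(\mu,\rho_N)=J_0(\mu,\rho_N)$ for every $\mu\in\mathcal{P}(X_0)$ and $\rho_N\in\mathcal{P}(R_N)$. (ii) Let $k\in\{0,\dots,N-1\}$, $\mu_k\in\mathcal{P}(X_k)$, $\rho_N\in\mathcal{P}(R_N)$ and $\varepsilon\ge 0$. Suppose that the Borel map $u_k^{\varepsilon/2}:X_k\times R_N\to U_k$ is $\frac{\varepsilon}{2}$-optimal for the ground-space recursion at stage $k$ and that $\gamma_k^{\varepsilon/2}\in\Gamma(\mu_k,\rho_N)$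 is an $\frac{\varepsilon}{2}$-optimal transport plan for $\mathcal{K}[j_k](\mu_k,\rho_N)$. Then $$\lambda_k^{\varepsilon}=\left(\mathrm{proj}_{X_k},\,u_k^{\varepsilon/2}\right)_{\#}\gamma_k^{\varepsilon/2}\in\mathcal{P}(X_k\times U_k),$$ where $\mathrm{proj}_{X_k}:X_k\times R_N\to X_k$ is the projection, is an $\varepsilon$-optimal state-input distribution at stage $k$. If $\varepsilon=0$, then $\lambda_k^\ast:=\lambda_k^{\varepsilon}$ is optimal. (iii) If, in (ii), $\gamma_k^{\varepsilon/2}$ is induced by a transport map $T_k^{\varepsilon/2}:X_k\to R_N$, i.e. $\gamma_k^{\varepsilon/2}=(\mathrm{id}_{X_k},T_k^{\varepsilon/2})_{\#}\mu_k$, then the $\varepsilon$-optimal state-input distribution reads $$\lambda_k^{\varepsilon}=\left(\mathrm{id}_{X_k},\,u_k^{\varepsilon/2}\circ(\mathrm{id}_{X_k},T_k^{\varepsilon/2})\right)_{\#}\mu_k .$$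
   Context: Standing assumptions: all spaces are Polish, all probability measures and all maps are Borel. $\mathcal{P}(X)$ is the set of Borel probability measures on $X$; $T_\#\mu$ is the pushforward, $(T_\#\mu)(A)=\mu(T^{-1}(A))$. For maps $h_1,h_2$ with common domain, $(h_1,h_2)(x)=(h_1(x),h_2(x))$. Optimal transport: for $\mu\in\mathcal{P}(S_1)$, $\nu\in\mathcal{P}(S_2)$, $\Gamma(\mu,\nu)$ is the set of $\gamma\in\mathcal{P}(S_1\times S_2)$ with marginals $\mu$ and $\nu$. For $c:S_1\times S_2\to[0,+\infty]$, $\mathcal{K}[c](\mu,\nu)=\inf_{\gamma\in\Gamma(\mu,\nu)}\int c\,d\gamma$. A plan $\gamma\in\Gamma(\mu,\nu)$ is $\varepsilon$-optimal if $\int c\,d\gamma\le\mathcal{K}[c](\mu,\nu)+\varepsilon$. Optimal control problem in probability spaces: since $g_k$ does not depend on the reference, the stage cost $\mathcal{K}[g_k](\lambda_k,\rho_k)$ (optimal transport discrepancy between $\lambda_k$ and a reference $\rho_k\in\mathcal{P}(R_k)$) equals the expected value $\int_{X_k\times U_k} g_k\,d\lambda_k$ and the references $\rho_0,\dots,\rho_{N-1}$ are irrelevant. For $\mu\in\mathcal{P}(X_0)$ and $\rho_N\in\mathcal{P}(R_N)$, $$J(\mu,\rho_N)=\inf\ \mathcal{K}[g_N](\mu_N,\rho_N)+\sum_{k=0}^{N-1}\int_{X_k\times U_k}g_k\,d\lambda_k,$$ the infimum being over $\mu_k\in\mathcal{P}(X_k)$ ($k=0,\dots,N$) and $\lambda_k\in\mathcal{P}(X_k\times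 U_k)$ ($k=0,\dots,N-1$) subject to $\mu_0=\mu$, $\mu_{k+1}=(f_k)_\#\lambda_k$, and the $X_k$-marginal of $\lambda_k$ being $\mu_k$. Dynamic programming algorithm in probability spaces: $J_N(\mu_N,\rho_N)=\mathcal{K}[g_N](\mu_N,\rho_N)$ and, for $k=N-1,\dots,0$, $$J_k(\mu_k,\rho_N)=\inf_{\lambda_k}\ \int_{X_k\times U_k}g_k\,d\lambda_k+J_{k+1}((f_k)_\#\lambda_k,\rho_N),$$ over $\lambda_k\in\mathcal{P}(X_k\times U_k)$ with $X_k$-marginal $\mu_k$. A state-input distribution $\lambda_k\in\mathcal{P}(X_k\times U_k)$ with $X_k$-marginal $\mu_k$ is $\varepsilon$-optimal (at stage $k$, for $\mu_k,\rho_N$) if $\int g_k\,d\lambda_k+J_{k+1}((f_k)_\#\lambda_k,\rho_N)\le J_k(\mu_k,\rho_N)+\varepsilon$, and optimal if this holds with $\varepsilon=0$. Dynamic programming algorithm in the ground space: $j_N(x_N,r_N)=g_N(x_N,r_N)$ and, for $k=N-1,\dots,0$, $$j_k(x_k,r_N)=\inf_{u\in U_k}\ g_k(x_k,u)+j_{k+1}(f_k(x_k,u),r_N).$$ A map $u_k:X_k\times R_N\to U_k$ is $\varepsilon$-optimal at stage $k$ if, for all $(x_k,r_N)$ and with $u=u_k(x_k,r_N)$, $g_k(x_k,u)+j_{k+1}(f_k(x_k,u),r_N)\le j_k(x_k,r_N)+\varepsilon$. Measurability: the functions $j_k$ need not be Borel but are lower semianalytic, hence universally measurable; integrals of $j_k$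 against a Borel probability measure are understood with respect to the completion of that measure. *)

theory Defs
  imports "HOL-Probability.Probability"
begin

text \<open>
  The families of spaces \<open>X 0, \<dots>, X N\<close>, \<open>U 0, \<dots>, U (N - 1)\<close>, \<open>R 0, \<dots>, R N\<close> are families of
  topologies on subsets of arbitrary types: every sequence of Polish spaces is of this form (take a
  disjoint union as the type), so the spaces may differ from stage to stage.  Functions are relevant
  only on the underlying sets (topspace).
\<close>

definition Polish_topology :: "'a topology \<Rightarrow> bool" where
  "Polish_topology S \<longleftrightarrow> completely_metrizable_space S \<and> separable_space S"

definition borel_of :: "'a topology \<Rightarrow> 'a measure" where
  "borel_of S = sigma (topspace S) {V. openin S V}"

definition prob_measures :: "'a topology \<Rightarrow> 'a measure set" where
  "prob_measures S = {\<mu>. prob_space \<mu> \<and> sets \<mu> = sets (borel_of S)}"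

definition couplings ::
  "'a topology \<Rightarrow> 'b topology \<Rightarrow> 'a measure \<Rightarrow> 'b measure \<Rightarrow> ('a \<times> 'b) measure set" where
  "couplings S1 S2 \<mu> \<nu> =
     {\<gamma> \<in> prob_measures (prod_topology S1 S2).
        distr \<gamma> (borel_of S1) fst = \<mu> \<and> distr \<gamma> (borel_of S2) snd = \<nu>}"

text \<open>
  Costs need only be universally measurable, so the integral is taken with respect to the completion
  of the plan; for Borel costs this is the ordinary integral (\<open>nn_integral_completion\<close>).
\<close>

definition transport_cost :: "('a \<times> 'b \<Rightarrow> ennreal) \<Rightarrow> ('a \<times> 'b) measure \<Rightarrow> ennreal" where
  "transport_cost c \<gamma> = (\<integral>\<^sup>+ z. c z \<partial>completion \<gamma>)"

definition ot_discrepancy ::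
  "'a topology \<Rightarrow> 'b topology \<Rightarrow> ('a \<times> 'b \<Rightarrow> ennreal) \<Rightarrow> 'a measure \<Rightarrow> 'b measure \<Rightarrow> ennreal" where
  "ot_discrepancy S1 S2 c \<mu> \<nu> = (INF \<gamma> \<in> couplings S1 S2 \<mu> \<nu>. transport_cost c \<gamma>)"

definition eps_optimal_plan ::
  "'a topology \<Rightarrow> 'b topology \<Rightarrow> ('a \<times> 'b \<Rightarrow> ennreal) \<Rightarrow> 'a measure \<Rightarrow> 'b measure \<Rightarrow> real
     \<Rightarrow> ('a \<times> 'b) measure \<Rightarrow> bool" where
  "eps_optimal_plan S1 S2 c \<mu> \<nu> \<epsilon> \<gamma> \<longleftrightarrow>
     \<gamma> \<in> couplings S1 S2 \<mu> \<nu> \<and>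
     transport_cost c \<gamma> \<le> ot_discrepancy S1 S2 c \<mu> \<nu> + ennreal \<epsilon>"

definition state_input_measures ::
  "'x topology \<Rightarrow> 'u topology \<Rightarrow> 'x measure \<Rightarrow> ('x \<times> 'u) measure set" where
  "state_input_measures S V \<mu> =
     {\<Lambda> \<in> prob_measures (prod_topology S V). distr \<Lambda> (borel_of S) fst = \<mu>}"

text \<open>
  The optimal control problem in probability spaces.  Only \<open>\<mu>s 0, \<dots>, \<mu>s N\<close> and
  \<open>\<Lambda>s 0, \<dots>, \<Lambda>s (N - 1)\<close> of the two sequences are used.
\<close>

definition admissible ::
  "nat \<Rightarrow> (nat \<Rightarrow> 'x topology) \<Rightarrow> (nat \<Rightarrow> 'u topology) \<Rightarrow> (nat \<Rightarrow> 'x \<times> 'u \<Rightarrow> 'x)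
     \<Rightarrow> 'x measure \<Rightarrow> (nat \<Rightarrow> 'x measure) \<Rightarrow> (nat \<Rightarrow> ('x \<times> 'u) measure) \<Rightarrow> bool" where
  "admissible N X U f \<mu> \<mu>s \<Lambda>s \<longleftrightarrow>
     (\<forall>k\<le>N. \<mu>s k \<in> prob_measures (X k)) \<and>
     (\<forall>k<N. \<Lambda>s k \<in> state_input_measures (X k) (U k) (\<mu>s k)) \<and>
     \<mu>s 0 = \<mu> \<and>
     (\<forall>k<N. \<mu>s (Suc k) = distr (\<Lambda>s k) (borel_of (X (Suc k))) (f k))"

definition control_value ::
  "nat \<Rightarrow> (nat \<Rightarrow> 'x topology) \<Rightarrow> (nat \<Rightarrow> 'u topology) \<Rightarrow> 'r topology \<Rightarrow> (nat \<Rightarrow> 'x \<times> 'u \<Rightarrow> 'x)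
     \<Rightarrow> (nat \<Rightarrow> 'x \<times> 'u \<Rightarrow> ennreal) \<Rightarrow> ('x \<times> 'r \<Rightarrow> ennreal) \<Rightarrow> 'x measure \<Rightarrow> 'r measure \<Rightarrow> ennreal" where
  "control_value N X U RN f g gN \<mu> \<rho> =
     (INF (\<mu>s, \<Lambda>s) \<in> {(\<mu>s, \<Lambda>s). admissible N X U f \<mu> \<mu>s \<Lambda>s}.
        ot_discrepancy (X N) RN gN (\<mu>s N) \<rho> + (\<Sum>k<N. \<integral>\<^sup>+ z. g k z \<partial>\<Lambda>s k))"

text \<open>Both recursions run backwards from stage \<open>N\<close>; stages \<open>k > N\<close> are junk.\<close>

function prob_cost_to_go ::
  "nat \<Rightarrow> (nat \<Rightarrow> 'x topology) \<Rightarrow> (nat \<Rightarrow> 'u topology) \<Rightarrow> 'r topology \<Rightarrow> (nat \<Rightarrow> 'x \<times> 'u \<Rightarrow> 'x)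
     \<Rightarrow> (nat \<Rightarrow> 'x \<times> 'u \<Rightarrow> ennreal) \<Rightarrow> ('x \<times> 'r \<Rightarrow> ennreal) \<Rightarrow> nat \<Rightarrow> 'x measure \<Rightarrow> 'r measure
     \<Rightarrow> ennreal" where
  "prob_cost_to_go N X U RN f g gN k \<mu> \<rho> =
     (if k < N
      then INF \<Lambda> \<in> state_input_measures (X k) (U k) \<mu>.
             (\<integral>\<^sup>+ z. g k z \<partial>\<Lambda>) +
             prob_cost_to_go N X U RN f g gN (Suc k) (distr \<Lambda> (borel_of (X (Suc k))) (f k)) \<rho>
      else ot_discrepancy (X N) RN gN \<mu> \<rho>)"
  by pat_completeness auto
termination
  by (relation "Wellfounded.measure (\<lambda>(N, X, U, RN, f, g, gN, k, \<mu>, \<rho>). N - k)") auto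

function ground_cost_to_go ::
  "nat \<Rightarrow> (nat \<Rightarrow> 'u topology) \<Rightarrow> (nat \<Rightarrow> 'x \<times> 'u \<Rightarrow> 'x) \<Rightarrow> (nat \<Rightarrow> 'x \<times> 'u \<Rightarrow> ennreal)
     \<Rightarrow> ('x \<times> 'r \<Rightarrow> ennreal) \<Rightarrow> nat \<Rightarrow> 'x \<times> 'r \<Rightarrow> ennreal" where
  "ground_cost_to_go N U f g gN k (x, r) =
     (if k < N
      then INF u \<in> topspace (U k). g k (x, u) + ground_cost_to_go N U f g gN (Suc k) (f k (x, u), r)
      else gN (x, r))"
  by pat_completeness auto
termination
  by (relation "Wellfounded.measure (\<lambda>(N, U, f, g, gN, k, z). N - k)") auto

declare prob_cost_to_go.simps [simp del] ground_cost_to_go.simps [simp del]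

definition eps_optimal_state_input ::
  "nat \<Rightarrow> (nat \<Rightarrow> 'x topology) \<Rightarrow> (nat \<Rightarrow> 'u topology) \<Rightarrow> 'r topology \<Rightarrow> (nat \<Rightarrow> 'x \<times> 'u \<Rightarrow> 'x)
     \<Rightarrow> (nat \<Rightarrow> 'x \<times> 'u \<Rightarrow> ennreal) \<Rightarrow> ('x \<times> 'r \<Rightarrow> ennreal) \<Rightarrow> nat \<Rightarrow> 'x measure \<Rightarrow> 'r measure
     \<Rightarrow> real \<Rightarrow> ('x \<times> 'u) measure \<Rightarrow> bool" where
  "eps_optimal_state_input N X U RN f g gN k \<mu> \<rho> \<epsilon> \<Lambda> \<longleftrightarrow>
     \<Lambda> \<in> state_input_measures (X k) (U k) \<mu> \<and>
     (\<integral>\<^sup>+ z. g k z \<partial>\<Lambda>) +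
       prob_cost_to_go N X U RN f g gN (Suc k) (distr \<Lambda> (borel_of (X (Suc k))) (f k)) \<rho>
     \<le> prob_cost_to_go N X U RN f g gN k \<mu> \<rho> + ennreal \<epsilon>"

definition optimal_state_input ::
  "nat \<Rightarrow> (nat \<Rightarrow> 'x topology) \<Rightarrow> (nat \<Rightarrow> 'u topology) \<Rightarrow> 'r topology \<Rightarrow> (nat \<Rightarrow> 'x \<times> 'u \<Rightarrow> 'x)
     \<Rightarrow> (nat \<Rightarrow> 'x \<times> 'u \<Rightarrow> ennreal) \<Rightarrow> ('x \<times> 'r \<Rightarrow> ennreal) \<Rightarrow> nat \<Rightarrow> 'x measure \<Rightarrow> 'r measure
     \<Rightarrow> ('x \<times> 'u) measure \<Rightarrow> bool" where
  "optimal_state_input N X U RN f g gN k \<mu> \<rho> \<Lambda> \<longleftrightarrow>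
     eps_optimal_state_input N X U RN f g gN k \<mu> \<rho> 0 \<Lambda>"

definition eps_optimal_input_map ::
  "nat \<Rightarrow> (nat \<Rightarrow> 'x topology) \<Rightarrow> (nat \<Rightarrow> 'u topology) \<Rightarrow> 'r topology \<Rightarrow> (nat \<Rightarrow> 'x \<times> 'u \<Rightarrow> 'x)
     \<Rightarrow> (nat \<Rightarrow> 'x \<times> 'u \<Rightarrow> ennreal) \<Rightarrow> ('x \<times> 'r \<Rightarrow> ennreal) \<Rightarrow> nat \<Rightarrow> real \<Rightarrow> ('x \<times> 'r \<Rightarrow> 'u) \<Rightarrow> bool" where
  "eps_optimal_input_map N X U RN f g gN k \<epsilon> u \<longleftrightarrow>
     u \<in> topspace (prod_topology (X k) RN) \<rightarrow> topspace (U k) \<and>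
     (\<forall>x \<in> topspace (X k). \<forall>r \<in> topspace RN.
        g k (x, u (x, r)) + ground_cost_to_go N U f g gN (Suc k) (f k (x, u (x, r)), r)
        \<le> ground_cost_to_go N U f g gN k (x, r) + ennreal \<epsilon>)"

end

theory Submission
  imports Defs
begin

text \<open>
  Each \<open>j k\<close> is an infimum \<open>j z = (INF \<sigma>. G (z, \<sigma>))\<close> of a Borel function over Baire space, because a
  Polish input space is a Borel image of Baire space.  Hence \<open>j k\<close> agrees almost everywhere with a
  Borel function, and for every finite measure there is a Borel input map that is \<open>\<epsilon>\<close>-optimal almost
  everywhere.  Pushing a plan \<open>\<gamma>\<close> for \<open>(\<mu>, \<rho>)\<close> forward under such a map gives a state-input
  distribution \<open>\<Lambda>\<close> and a plan for \<open>(f\<^sub>#\<Lambda>, \<rho>)\<close> with total cost at most that of \<open>\<gamma>\<close> plus \<open>\<epsilon>\<close>.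
  Conversely \<open>\<Lambda>\<close> and a plan for \<open>(f\<^sub>#\<Lambda>, \<rho>)\<close> can be glued along \<open>f\<close>, and the glued measure has a
  marginal in \<open>\<Gamma>(\<mu>, \<rho>)\<close> that costs no more.  So both recursions satisfy the same one-step equation.
\<close>

subsection \<open>Borel sets of Polish topologies\<close>

text \<open>The obstacle is measurability. An infimum over inputs of a Borel function need not be
  Borel, and a Borel function that equals \<open>j k\<close> almost everywhere depends on the
  measure, whereas every step of the recursion replaces the measure by its image under the dynamics.
  The induction therefore carries the measure-free representation as an infimum over Baire space,
  which survives composition with Borel maps, addition of a Borel cost and a further infimum; a
  measure is fixed only when an integral is computed or an input map is produced. Minimisers may
  fail to exist, so selection is only up to \<epsilon> > 0, and \<epsilon> tends to 0 in the value
  identity. Baire space suits the selection because its finite sequences form a countable tree: a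
  solution is searched entry by entry, at the price of one null set per node. An empty input space
  is no image of Baire space; there the infimum is infinite and the identity is checked
  directly.\<close>

lemma space_borel_of [simp]: "space (borel_of S) = topspace S"
  unfolding borel_of_def by (rule space_measure_of) (auto dest: openin_subset)

lemma sets_borel_of: "sets (borel_of S) = sigma_sets (topspace S) {V. openin S V}"
  unfolding borel_of_def by (rule sets_measure_of) (auto dest: openin_subset)

lemma borel_of_openin: "openin S V \<Longrightarrow> V \<in> sets (borel_of S)"
  by (auto simp: sets_borel_of)

lemma borel_of_closedin: "closedin S C \<Longrightarrow> C \<in> sets (borel_of S)"
proof -
  assume C: "closedin S C"
  then have "space (borel_of S) - (topspace S - C) \<in> sets (borel_of S)"
    by (intro sets.compl_sets borel_of_openin) (auto simp: closedin_def)
  moreover have "space (borel_of S) - (topspace S - C) = C"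
    using closedin_subset[OF C] by auto
  ultimately show ?thesis by simp
qed

lemma measurable_borel_of_continuous_map:
  assumes "continuous_map S T h" shows "h \<in> borel_of S \<rightarrow>\<^sub>M borel_of T"
  unfolding borel_of_def[of T]
proof (rule measurable_measure_of)
  show "h \<in> space (borel_of S) \<rightarrow> topspace T"
    using continuous_map_image_subset_topspace[OF assms] by auto
  show "h -` V \<inter> space (borel_of S) \<in> sets (borel_of S)" if "V \<in> {V. openin T V}" for V
  proof -
    have "h -` V \<inter> space (borel_of S) = {x \<in> topspace S. h x \<in> V}" by auto
    then show ?thesis
      using that openin_continuous_map_preimage[OF assms] by (auto intro: borel_of_openin)
  qed
qed (auto dest: openin_subset)

lemma Polish_topology_metric:
  assumes "Polish_topology S"
  obtains M d C where "Metric_space M d" "Metric_space.mcomplete M d"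
    "S = Metric_space.mtopology M d" "countable C" "C \<subseteq> M"
    "\<And>x e. x \<in> M \<Longrightarrow> e > 0 \<Longrightarrow> \<exists>c\<in>C. d c x < e"
proof -
  obtain M d where Md: "Metric_space M d" "Metric_space.mcomplete M d"
    "S = Metric_space.mtopology M d"
    using assms unfolding Polish_topology_def completely_metrizable_space_def by auto
  interpret Metric_space M d by fact
  obtain C where C: "countable C" "C \<subseteq> M" "S closure_of C = M"
    using assms Md unfolding Polish_topology_def separable_space_def by auto
  have "\<exists>c\<in>C. d c x < e" if x: "x \<in> M" and e: "e > 0" for x e
  proof -
    have "x \<in> mtopology closure_of C" using x C(3) Md(3) by simp
    then obtain c where "c \<in> C" "c \<in> mball x e"
      using e unfolding metric_closure_of by blast
    then show ?thesis by (auto simp: commute)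
  qed
  with Md C that show ?thesis by blast
qed

lemma Polish_topology_Hausdorff: "Polish_topology S \<Longrightarrow> Hausdorff_space S"
  using Polish_topology_metric Metric_space.Hausdorff_space_mtopology by metis

lemma Polish_topology_second_countable:
  assumes "Polish_topology S" shows "second_countable S"
proof -
  obtain M d C where Md: "Metric_space M d" "Metric_space.mcomplete M d"
    "S = Metric_space.mtopology M d" and C: "countable C" "C \<subseteq> M"
    "\<And>x e. x \<in> M \<Longrightarrow> e > 0 \<Longrightarrow> \<exists>c\<in>C. d c x < e"
    using Polish_topology_metric[OF assms] by metis
  interpret Metric_space M d by fact
  let ?B = "(\<lambda>(c, n). mball c (inverse (real (Suc n)))) ` (C \<times> UNIV)"
  have "\<exists>V\<in>?B. x \<in> V \<and> V \<subseteq> W" if W: "openin S W" "x \<in> W" for W x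
  proof -
    have x: "x \<in> M" using W Md(3) openin_subset by fastforce
    obtain r where r: "r > 0" "mball x r \<subseteq> W"
      using W unfolding Md(3) openin_mtopology by blast
    obtain n where n: "inverse (real (Suc n)) < r / 2"
      using r(1) reals_Archimedean[of "r / 2"] by auto
    obtain c where c: "c \<in> C" "d c x < inverse (real (Suc n))"
      using C(3)[OF x, of "inverse (real (Suc n))"] by auto
    have "mball c (inverse (real (Suc n))) \<subseteq> mball x r"
    proof
      fix y assume y: "y \<in> mball c (inverse (real (Suc n)))"
      then have "d x y \<le> d x c + d c y" using x by (intro triangle) auto
      then show "y \<in> mball x r" using y c x n by (auto simp: commute)
    qed
    moreover have "x \<in> mball c (inverse (real (Suc n)))" using c C(2) x by auto
    ultimately show ?thesis using r(2) c(1) by force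
  qed
  then have "countable ?B \<and> (\<forall>V\<in>?B. openin S V) \<and>
      (\<forall>W x. openin S W \<and> x \<in> W \<longrightarrow> (\<exists>V\<in>?B. x \<in> V \<and> V \<subseteq> W))"
    using C(1) by (auto simp: Md(3))
  then show ?thesis unfolding second_countable_def by blast
qed

text \<open>Second countability enters in the inclusion of the Borel sets of the product topology:
  an open set is the union of the base rectangles it contains, and these are countably many. The
  other inclusion is continuity of the projections.\<close>

lemma sets_borel_of_prod:
  assumes "second_countable S" "second_countable T"
  shows "sets (borel_of (prod_topology S T)) = sets (borel_of S \<Otimes>\<^sub>M borel_of T)"
proof
  let ?P = "prod_topology S T"
  obtain \<A> where A: "countable \<A>" "\<And>V. V \<in> \<A> \<Longrightarrow> openin S V"
    "\<And>W x. openin S W \<Longrightarrow> x \<in> W \<Longrightarrow> \<exists>V\<in>\<A>. x \<in> V \<and> V \<subseteq> W"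
    using assms(1) unfolding second_countable_def by metis
  obtain \<B> where B: "countable \<B>" "\<And>V. V \<in> \<B> \<Longrightarrow> openin T V"
    "\<And>W x. openin T W \<Longrightarrow> x \<in> W \<Longrightarrow> \<exists>V\<in>\<B>. x \<in> V \<and> V \<subseteq> W"
    using assms(2) unfolding second_countable_def by metis
  have "W \<in> sets (borel_of S \<Otimes>\<^sub>M borel_of T)" if W: "openin ?P W" for W
  proof -
    let ?I = "{(V, V'). (V, V') \<in> \<A> \<times> \<B> \<and> V \<times> V' \<subseteq> W}"
    have "W \<subseteq> (\<Union>(V, V')\<in>?I. V \<times> V')"
    proof
      fix z assume "z \<in> W"
      obtain x y where z: "z = (x, y)" by (cases z)
      have "\<exists>V V'. openin S V \<and> openin T V' \<and> x \<in> V \<and> y \<in> V' \<and> V \<times> V' \<subseteq> W"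
        using W \<open>z \<in> W\<close> z by (simp only: openin_prod_topology_alt)
      then obtain V V' where V: "openin S V" "openin T V'" "x \<in> V" "y \<in> V'" "V \<times> V' \<subseteq> W"
        by blast
      then obtain V1 V1' where "V1 \<in> \<A>" "x \<in> V1" "V1 \<subseteq> V" "V1' \<in> \<B>" "y \<in> V1'" "V1' \<subseteq> V'"
        using A(3) B(3) by meson
      then show "z \<in> (\<Union>(V, V')\<in>?I. V \<times> V')"
        using z \<open>V \<times> V' \<subseteq> W\<close> by blast
    qed
    then have "W = (\<Union>(V, V')\<in>?I. V \<times> V')" by auto
    moreover have "(\<Union>(V, V')\<in>?I. V \<times> V') \<in> sets (borel_of S \<Otimes>\<^sub>M borel_of T)"
    proof (rule sets.countable_UN'')
      show "countable ?I" by (rule countable_subset[of _ "\<A> \<times> \<B>"]) (use A(1) B(1) in auto)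
      show "(case i of (V, V') \<Rightarrow> V \<times> V') \<in> sets (borel_of S \<Otimes>\<^sub>M borel_of T)" if "i \<in> ?I" for i
        using that A(2) B(2) by (cases i) (simp add: pair_measureI borel_of_openin)
    qed
    ultimately show ?thesis by simp
  qed
  moreover have "topspace S \<times> topspace T \<in> sets (borel_of S \<Otimes>\<^sub>M borel_of T)"
    using sets.top[of "borel_of S \<Otimes>\<^sub>M borel_of T"] by (simp only: space_pair_measure space_borel_of)
  ultimately show "sets (borel_of ?P) \<subseteq> sets (borel_of S \<Otimes>\<^sub>M borel_of T)"
    unfolding sets_borel_of[of ?P] topspace_prod_topology by (intro sets.sigma_sets_subset') auto
  have "fst \<in> borel_of ?P \<rightarrow>\<^sub>M borel_of S" "snd \<in> borel_of ?P \<rightarrow>\<^sub>M borel_of T"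
    by (auto intro!: measurable_borel_of_continuous_map continuous_map_fst continuous_map_snd)
  then have "(\<lambda>z. z) \<in> borel_of ?P \<rightarrow>\<^sub>M borel_of S \<Otimes>\<^sub>M borel_of T"
    by (simp add: measurable_pair_iff comp_def)
  then have "(\<lambda>z. z) -` A \<inter> space (borel_of ?P) \<in> sets (borel_of ?P)"
    if "A \<in> sets (borel_of S \<Otimes>\<^sub>M borel_of T)" for A
    using that by (rule measurable_sets)
  moreover have "A \<subseteq> topspace S \<times> topspace T" if "A \<in> sets (borel_of S \<Otimes>\<^sub>M borel_of T)" for A
    using sets.sets_into_space[OF that] by (simp add: space_pair_measure)
  ultimately show "sets (borel_of S \<Otimes>\<^sub>M borel_of T) \<subseteq> sets (borel_of ?P)"
    by (auto simp: Int_absorb2)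
qed

text \<open>The product sigma-algebra is the Borel one here, as the factors are countable and
  discrete. Topological arguments are expressed later by dependence on finitely many
  coordinates.\<close>

definition baire :: "(nat \<Rightarrow> nat) measure" where
  "baire = PiM UNIV (\<lambda>_. count_space UNIV)"

lemma space_baire [simp]: "space baire = UNIV"
  by (auto simp: baire_def space_PiM)

lemma measurable_baire_component [measurable]: "(\<lambda>\<sigma>. \<sigma> i) \<in> baire \<rightarrow>\<^sub>M count_space UNIV"
  unfolding baire_def by (rule measurable_component_singleton) simp

lemma measurable_baireI:
  assumes "\<And>i. (\<lambda>x. h x i) \<in> M \<rightarrow>\<^sub>M count_space UNIV"
  shows "h \<in> M \<rightarrow>\<^sub>M baire"
  unfolding baire_def by (rule measurable_PiM_single') (use assms in auto)

text \<open>
  \<open>\<sigma>\<close> lists indices into a dense sequence, and an entry that would move the current point by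
  more than \<open>2\<^sup>-\<^sup>n\<close> is ignored; so every \<open>\<sigma>\<close> yields a Cauchy sequence and every point is reached.
\<close>

lemma Polish_topology_baire_surjection:
  assumes "Polish_topology S" "topspace S \<noteq> {}"
  obtains \<phi> where "\<phi> \<in> baire \<rightarrow>\<^sub>M borel_of S" "range \<phi> = topspace S"
proof -
  obtain M d C where Md: "Metric_space M d" "Metric_space.mcomplete M d"
    "S = Metric_space.mtopology M d" and C: "countable C" "C \<subseteq> M"
    "\<And>x e. x \<in> M \<Longrightarrow> e > 0 \<Longrightarrow> \<exists>c\<in>C. d c x < e"
    using Polish_topology_metric[OF assms(1)] by metis
  interpret Metric_space M d by fact
  have M: "topspace S = M" by (simp add: Md(3))
  have "C \<noteq> {}" using assms(2) C(3)[of _ 1] by (auto simp: M)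
  define c where "c = from_nat_into C"
  have c: "c n \<in> M" for n using from_nat_into[OF \<open>C \<noteq> {}\<close>] C(2) by (auto simp: c_def)
  have dense: "\<exists>n. d (c n) x < e" if "x \<in> M" "e > 0" for x e
    using C(3)[OF that] from_nat_into_surj[OF C(1)] by (metis c_def)
  \<comment> \<open>\<open>k \<sigma> n\<close> is the index in force at time \<open>n\<close>.
    Indices instead of points keep every stage countably valued, so measurability is proved by cases
    over the current value.\<close>
  define k where "k \<sigma> = rec_nat (\<sigma> 0)
    (\<lambda>n i. if d (c i) (c (\<sigma> (Suc n))) < (1/2)^n then \<sigma> (Suc n) else i)" for \<sigma> :: "nat \<Rightarrow> nat"
  have k0: "k \<sigma> 0 = \<sigma> 0" for \<sigma> by (simp add: k_def)
  have kS: "k \<sigma> (Suc n) =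
      (if d (c (k \<sigma> n)) (c (\<sigma> (Suc n))) < (1/2)^n then \<sigma> (Suc n) else k \<sigma> n)" for \<sigma> n
    by (simp add: k_def)
  have k_meas: "(\<lambda>\<sigma>. k \<sigma> n) \<in> baire \<rightarrow>\<^sub>M count_space UNIV" for n
  proof (induction n)
    case 0 then show ?case by (simp add: k0)
  next
    case (Suc n)
    have "(\<lambda>\<sigma>. if d (c i) (c (\<sigma> (Suc n))) < (1/2)^n then \<sigma> (Suc n) else i)
        \<in> baire \<rightarrow>\<^sub>M count_space UNIV" for i
      by (rule measurable_compose[OF measurable_baire_component, where
            g = "\<lambda>j. if d (c i) (c j) < (1/2)^n then j else i"]) simp
    then have "(\<lambda>\<sigma>. if d (c (k \<sigma> n)) (c (\<sigma> (Suc n))) < (1/2)^n then \<sigma> (Suc n) else k \<sigma> n)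
        \<in> baire \<rightarrow>\<^sub>M count_space UNIV"
      by (rule measurable_compose_countable[where g = "\<lambda>\<sigma>. k \<sigma> n", OF _ Suc])
    then show ?case by (simp only: kS)
  qed
  have step: "d (c (k \<sigma> n)) (c (k \<sigma> (Suc n))) \<le> (1/2)^n" for \<sigma> n
    by (auto simp: kS c)
  \<comment> \<open>The bound is the exact partial geometric sum; the weaker
    \<open>2 * (1/2)^n\<close> of \<open>tail'\<close> would not pass through the induction.\<close>
  have tail: "d (c (k \<sigma> n)) (c (k \<sigma> (n + m))) \<le> 2 * (1/2)^n - 2 * (1/2)^(n+m)" for \<sigma> n m
  proof (induction m)
    case 0 then show ?case by (simp add: c)
  next
    case (Suc m)
    have "d (c (k \<sigma> n)) (c (k \<sigma> (n + Suc m)))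
        \<le> d (c (k \<sigma> n)) (c (k \<sigma> (n + m))) + d (c (k \<sigma> (n + m))) (c (k \<sigma> (Suc (n + m))))"
      using triangle[OF c c c] by simp
    also have "\<dots> \<le> 2 * (1/2)^n - 2 * (1/2)^(n+m) + (1/2)^(n+m)"
      using Suc step[of \<sigma> "n + m"] by linarith
    finally show ?case by simp
  qed
  have tail': "d (c (k \<sigma> n)) (c (k \<sigma> m)) \<le> 2 * (1/2)^n" if "n \<le> m" for \<sigma> n m
  proof -
    have "d (c (k \<sigma> n)) (c (k \<sigma> m)) \<le> 2 * (1/2)^n - 2 * (1/2)^m"
      using tail[of \<sigma> n "m - n"] that by simp
    moreover have "(0::real) \<le> 2 * (1/2)^m" by simp
    ultimately show ?thesis by linarith
  qed
  have half: "\<exists>n. a * (1/2)^n < (e::real)" if "e > 0" "a > 0" for a e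
    using real_arch_pow_inv[of "e / a" "1/2"] that by (auto simp: field_simps)
  have "MCauchy (\<lambda>n. c (k \<sigma> n))" for \<sigma>
    unfolding MCauchy_def
  proof safe
    fix e :: real assume "e > 0"
    then obtain n0 where n0: "2 * (1/2)^n0 < e" using half[of e 2] by auto
    have "d (c (k \<sigma> n)) (c (k \<sigma> m)) < e" if "n0 \<le> n" "n \<le> m" for n m
    proof -
      have "2 * (1/2)^n \<le> 2 * (1/2::real)^n0" using that by (simp add: power_decreasing)
      then show ?thesis using tail'[OF that(2), of \<sigma>] n0 by linarith
    qed
    then show "\<exists>n0. \<forall>n n'. n0 \<le> n \<longrightarrow> n0 \<le> n' \<longrightarrow> d (c (k \<sigma> n)) (c (k \<sigma> n')) < e"
      by (metis commute linorder_le_cases)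
  qed (use c in auto)
  then have "\<exists>x. limitin mtopology (\<lambda>n. c (k \<sigma> n)) x sequentially" for \<sigma>
    using Md(2) unfolding mcomplete_def by blast
  then obtain \<phi> where lim: "\<And>\<sigma>. limitin mtopology (\<lambda>n. c (k \<sigma> n)) (\<phi> \<sigma>) sequentially"
    by metis
  have \<phi>M: "\<phi> \<sigma> \<in> M" for \<sigma> using limitin_topspace[OF lim] by simp
  have close: "d (c (k \<sigma> n)) (\<phi> \<sigma>) \<le> 2 * (1/2)^n" for \<sigma> n
  proof (rule field_le_epsilon)
    fix e :: real assume "e > 0"
    then obtain n0 where "\<And>m. m \<ge> n0 \<Longrightarrow> d (c (k \<sigma> m)) (\<phi> \<sigma>) < e"
      using lim[of \<sigma>] unfolding limit_metric_sequentially by blast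
    then have "d (c (k \<sigma> (max n n0))) (\<phi> \<sigma>) < e" by simp
    moreover have "d (c (k \<sigma> n)) (\<phi> \<sigma>)
        \<le> d (c (k \<sigma> n)) (c (k \<sigma> (max n n0))) + d (c (k \<sigma> (max n n0))) (\<phi> \<sigma>)"
      by (intro triangle c \<phi>M)
    ultimately show "d (c (k \<sigma> n)) (\<phi> \<sigma>) \<le> 2 * (1/2)^n + e"
      using tail'[of n "max n n0" \<sigma>] by simp
  qed
  \<comment> \<open>The limit is within \<open>2 * (1/2)^n\<close> of the point at time
    \<open>n\<close>, hence inside the ball of radius \<open>4 * (1/2)^n\<close>, and that whole
    ball is within \<open>6 * (1/2)^n\<close> of the limit. So membership in an open set is a
    countable union of conditions on single indices.\<close>
  have preimage: "\<phi> \<sigma> \<in> V \<longleftrightarrow> (\<exists>n. mball (c (k \<sigma> n)) (4 * (1/2)^n) \<subseteq> V)"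
    if V: "openin S V" for V \<sigma>
  proof
    assume "\<phi> \<sigma> \<in> V"
    then obtain r where r: "r > 0" "mball (\<phi> \<sigma>) r \<subseteq> V"
      using V unfolding Md(3) openin_mtopology by blast
    obtain n where n: "6 * (1/2)^n < r" using half[of r 6] r(1) by auto
    have "z \<in> mball (\<phi> \<sigma>) r" if "z \<in> mball (c (k \<sigma> n)) (4 * (1/2)^n)" for z
    proof -
      have "d (\<phi> \<sigma>) z \<le> d (\<phi> \<sigma>) (c (k \<sigma> n)) + d (c (k \<sigma> n)) z"
        using that by (intro triangle c \<phi>M) auto
      also have "\<dots> < r" using that close[of \<sigma> n] n by (auto simp: commute)
      finally show ?thesis using that \<phi>M by auto
    qed
    then show "\<exists>n. mball (c (k \<sigma> n)) (4 * (1/2)^n) \<subseteq> V" using r(2) by blast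
  next
    assume "\<exists>n. mball (c (k \<sigma> n)) (4 * (1/2)^n) \<subseteq> V"
    then obtain n where "mball (c (k \<sigma> n)) (4 * (1/2)^n) \<subseteq> V" ..
    moreover have "d (c (k \<sigma> n)) (\<phi> \<sigma>) < 4 * (1/2)^n"
      using close[of \<sigma> n] by (rule le_less_trans) simp
    ultimately show "\<phi> \<sigma> \<in> V" using c \<phi>M by auto
  qed
  show ?thesis
  proof (rule that)
    show "\<phi> \<in> baire \<rightarrow>\<^sub>M borel_of S"
      unfolding borel_of_def
    proof (rule measurable_measure_of)
      fix V assume "V \<in> {V. openin S V}"
      then have "\<phi> -` V \<inter> space baire = (\<Union>n. (\<lambda>\<sigma>. k \<sigma> n) -`
          {i. mball (c i) (4 * (1/2)^n) \<subseteq> V} \<inter> space baire)"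
        using preimage by auto
      also have "\<dots> \<in> sets baire"
        by (intro sets.countable_UN image_subsetI measurable_sets[OF k_meas]) auto
      finally show "\<phi> -` V \<inter> space baire \<in> sets baire" .
    qed (use \<phi>M M openin_subset in auto)
    show "range \<phi> = topspace S"
    proof
      show "topspace S \<subseteq> range \<phi>"
      proof
        fix x assume "x \<in> topspace S"
        then have x: "x \<in> M" by (simp add: M)
        \<comment> \<open>With the factor 1/4, consecutive entries are closer than 3/8 of
          \<open>(1/2)^n\<close>, so no entry of this \<open>\<sigma>\<close> is ignored.\<close>
        then have "\<exists>i. d (c i) x < (1/2)^n / 4" for n by (intro dense) auto
        then obtain \<sigma> where \<sigma>: "\<And>n. d (c (\<sigma> n)) x < (1/2)^n / 4" by metis
        have "k \<sigma> n = \<sigma> n" for n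
        proof (induction n)
          case (Suc n)
          have "d (c (\<sigma> n)) (c (\<sigma> (Suc n))) \<le> d (c (\<sigma> n)) x + d x (c (\<sigma> (Suc n)))"
            by (intro triangle c x)
          also have "\<dots> < (1/2)^n / 4 + (1/2)^Suc n / 4"
            using \<sigma>[of n] \<sigma>[of "Suc n"] by (auto simp: commute)
          also have "\<dots> \<le> (1/2)^n" by simp
          finally show ?case by (simp add: kS Suc)
        qed (simp add: k0)
        have "d x (\<phi> \<sigma>) \<le> 0 + e" if e: "e > 0" for e
        proof -
          obtain n where n: "3 * (1/2)^n < e" using half[of e 3] e by auto
          have "d x (\<phi> \<sigma>) \<le> d x (c (\<sigma> n)) + d (c (\<sigma> n)) (\<phi> \<sigma>)" by (intro triangle c x \<phi>M)
          also have "\<dots> \<le> (1/2)^n / 4 + 2 * (1/2)^n"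
            using close[of \<sigma> n] \<sigma>[of n] \<open>k \<sigma> n = \<sigma> n\<close> by (auto simp: commute)
          also have "\<dots> \<le> 3 * (1/2)^n" by simp
          finally show ?thesis using n by simp
        qed
        then have "d x (\<phi> \<sigma>) \<le> 0" by (rule field_le_epsilon)
        then have "x = \<phi> \<sigma>" using nonneg[of x "\<phi> \<sigma>"] x \<phi>M[of \<sigma>] by auto
        then show "x \<in> range \<phi>" by simp
      qed
    qed (use \<phi>M M in auto)
  qed
qed

subsection \<open>Measurable selection\<close>

text \<open>A clopen condition on the Baire coordinate with measurable sections; countable
  conjunctions of such conditions describe closed sets. The number \<open>m\<close> of inspected
  entries is uniform in \<open>x\<close>, so a finite sequence of that length decides
  \<open>Q\<close> for all points at once.\<close>

definition finitary :: "'a measure \<Rightarrow> ('a \<Rightarrow> (nat \<Rightarrow> nat) \<Rightarrow> bool) \<Rightarrow> bool" where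
  "finitary M Q \<longleftrightarrow> (\<forall>\<omega>. {x \<in> space M. Q x \<omega>} \<in> sets M) \<and>
     (\<exists>m. \<forall>\<omega> \<omega>'. (\<forall>i<m. \<omega> i = \<omega>' i) \<longrightarrow> (\<forall>x. Q x \<omega> = Q x \<omega>'))"

text \<open>
  Lusin's argument.  \<open>H s\<close> is a measurable hull of the set \<open>E s\<close> of points having a solution that
  extends the finite sequence \<open>s\<close>.  Since \<open>E s\<close> is the union of the \<open>E (s @ [i])\<close>, the hull \<open>H s\<close> is
  covered up to a null set by the hulls \<open>H (s @ [i])\<close>.  Off the union of these countably many null
  sets, following the least admissible child stays in the hulls forever, and the limit branch is a
  measurable solution because the \<open>Q n\<close> are finitary.
\<close>

lemma finitary_branch_selection:
  assumes "finite_measure M" and Q: "\<And>n::nat. finitary M (Q n)"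
  obtains D H w where "D \<in> sets M" "H \<in> sets M" "H - D \<in> null_sets M"
    "{x \<in> space M. \<exists>\<omega>. \<forall>n. Q n x \<omega>} \<subseteq> H" "w \<in> M \<rightarrow>\<^sub>M baire" "\<And>x n. x \<in> D \<Longrightarrow> Q n x (w x)"
proof -
  interpret finite_measure M by fact
  obtain m where m: "\<And>n \<omega> \<omega>' x. (\<And>i. i < m n \<Longrightarrow> \<omega> i = \<omega>' i) \<Longrightarrow> Q n x \<omega> = Q n x \<omega>'"
    using Q unfolding finitary_def by metis
  have Q_sets: "{x \<in> space M. Q n x \<omega>} \<in> sets M" for n \<omega>
    using Q unfolding finitary_def by blast
  define E where "E s = {x \<in> space M. \<exists>\<omega>. (\<forall>i<length s. \<omega> i = s ! i) \<and> (\<forall>n. Q n x \<omega>)}" for s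
  \<comment> \<open>The filler 0 is immaterial: \<open>pad s\<close> is tested only on those
    \<open>Q n\<close> that inspect no entry beyond the end of \<open>s\<close>.\<close>
  define pad where "pad s i = (if i < length s then s ! i else 0)" for s :: "nat list" and i
  define A where "A s = {x \<in> space M. \<forall>n. m n \<le> length s \<longrightarrow> Q n x (pad s)}" for s
  have A_sets: "A s \<in> sets M" for s
    unfolding A_def
  proof (rule sets.sets_Collect_countable_All)
    show "{x \<in> space M. m n \<le> length s \<longrightarrow> Q n x (pad s)} \<in> sets M" for n
      using Q_sets[of n "pad s"] by (cases "m n \<le> length s") auto
  qed
  have E_A: "E s \<subseteq> A s" for s
  proof
    fix x assume "x \<in> E s"
    then obtain \<omega> where \<omega>: "x \<in> space M" "\<And>i. i < length s \<Longrightarrow> \<omega> i = s ! i" "\<And>n. Q n x \<omega>"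
      unfolding E_def by blast
    have "Q n x (pad s)" if "m n \<le> length s" for n
    proof -
      have "Q n x \<omega> = Q n x (pad s)" by (rule m) (use that \<omega>(2) in \<open>auto simp: pad_def\<close>)
      with \<omega>(3) show ?thesis by simp
    qed
    then show "x \<in> A s" using \<omega>(1) by (auto simp: A_def)
  qed
  have "\<exists>G. measurable_envelope M (E s) G" for s
    using measurable_envelopeI_countable_cover[of "E s" "\<lambda>_. space M" M]
    by (auto simp: E_def top.not_eq_extremum[symmetric])
  then obtain G where G: "\<And>s. measurable_envelope M (E s) (G s)" by metis
  \<comment> \<open>An envelope alone may contain points that violate conditions already decided by
    \<open>s\<close>. Since \<open>E s\<close> lies in \<open>A s\<close>, cutting with
    \<open>A s\<close> still leaves a measurable hull, and staying in the hulls now enforces every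
    \<open>Q n\<close>.\<close>
  define H where "H s = G s \<inter> A s" for s
  have H_sets: "H s \<in> sets M" for s
    using measurable_envelopeD(2)[OF G] A_sets by (auto simp: H_def)
  have E_H: "E s \<subseteq> H s" for s
    using measurable_envelopeD(1)[OF G] E_A by (auto simp: H_def)
  define N where "N = (\<Union>s. H s - (\<Union>i. H (s @ [i])))"
  have "H s - (\<Union>i. H (s @ [i])) \<in> null_sets M" for s
  proof (rule null_setsI)
    have "E s \<subseteq> (\<Union>i. E (s @ [i]))"
    proof
      fix x assume "x \<in> E s"
      then obtain \<omega> where \<omega>: "x \<in> space M" "\<forall>i<length s. \<omega> i = s ! i" "\<forall>n. Q n x \<omega>"
        unfolding E_def by blast
      then have "x \<in> E (s @ [\<omega> (length s)])"
        unfolding E_def by (auto simp: nth_append less_Suc_eq intro!: exI[of _ \<omega>])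
      then show "x \<in> (\<Union>i. E (s @ [i]))" by blast
    qed
    then have "E s \<subseteq> (\<Union>i. H (s @ [i]))" using E_H by blast
    moreover have "H s \<subseteq> G s" by (auto simp: H_def)
    ultimately have "H s - (\<Union>i. H (s @ [i])) \<subseteq> G s - E s" by blast
    then show "emeasure M (H s - (\<Union>i. H (s @ [i]))) = 0"
      by (intro measurable_envelopeD1[OF G]) (auto intro!: H_sets)
  qed (auto intro!: H_sets)
  then have N_null: "N \<in> null_sets M"
    unfolding N_def by (intro null_sets_UN') auto
  \<comment> \<open>If no child hull contains \<open>x\<close>, the \<open>LEAST\<close> is an
    arbitrary value. Along the branch of a point of \<open>H [] - N\<close> this never
    happens.\<close>
  define p where "p x n = rec_nat [] (\<lambda>_ s. s @ [LEAST i. x \<in> H (s @ [i])]) n" for x n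
  define w where "w x n = (LEAST i. x \<in> H (p x n @ [i]))" for x n
  have p0: "p x 0 = []" and pS: "p x (Suc n) = p x n @ [w x n]" for x n
    by (simp_all add: p_def w_def)
  have least_meas: "(\<lambda>x. LEAST i. x \<in> H (s @ [i])) \<in> M \<rightarrow>\<^sub>M count_space UNIV" for s
    using H_sets[measurable] by measurable
  have p_meas: "(\<lambda>x. p x n) \<in> M \<rightarrow>\<^sub>M count_space UNIV" for n
  proof (induction n)
    case (Suc n)
    have "(\<lambda>x. s @ [LEAST i. x \<in> H (s @ [i])]) \<in> M \<rightarrow>\<^sub>M count_space UNIV" for s
      by (rule measurable_compose[OF least_meas, where g = "\<lambda>i. s @ [i]"]) simp
    then have "(\<lambda>x. p x n @ [LEAST i. x \<in> H (p x n @ [i])]) \<in> M \<rightarrow>\<^sub>M count_space UNIV"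
      by (rule measurable_compose_countable[where g = "\<lambda>x. p x n", OF _ Suc])
    then show ?case by (simp only: pS w_def)
  qed (simp add: p0)
  have w_meas: "w \<in> M \<rightarrow>\<^sub>M baire"
  proof (rule measurable_baireI)
    fix n
    have "(\<lambda>x. LEAST i. x \<in> H (p x n @ [i])) \<in> M \<rightarrow>\<^sub>M count_space UNIV"
      by (rule measurable_compose_countable[where g = "\<lambda>x. p x n", OF least_meas p_meas])
    then show "(\<lambda>x. w x n) \<in> M \<rightarrow>\<^sub>M count_space UNIV" by (simp only: w_def)
  qed
  have len: "length (p x n) = n" for x n by (induction n) (simp_all add: p0 pS)
  have p_nth: "i < n \<Longrightarrow> p x n ! i = w x i" for x n i
    by (induction n) (auto simp: p0 pS nth_append len less_Suc_eq)
  have branch: "x \<in> H (p x n)" if "x \<in> H [] - N" for x n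
  proof (induction n)
    case (Suc n)
    then have "\<exists>i. x \<in> H (p x n @ [i])" using that unfolding N_def by blast
    then have "x \<in> H (p x n @ [w x n])" unfolding w_def by (rule LeastI_ex)
    then show ?case by (simp add: pS)
  qed (use that in \<open>simp add: p0\<close>)
  show ?thesis
  proof (rule that)
    show "H [] - N \<in> sets M" using H_sets N_null by auto
    have "H [] - (H [] - N) = H [] \<inter> N" by auto
    then show "H [] - (H [] - N) \<in> null_sets M" using null_set_Int1[OF N_null H_sets[of "[]"]] by simp
    show "{x \<in> space M. \<exists>\<omega>. \<forall>n. Q n x \<omega>} \<subseteq> H []" using E_H[of "[]"] by (simp add: E_def)
    fix x n assume "x \<in> H [] - N"
    \<comment> \<open>At depth \<open>m n\<close> the branch is just long enough to decide
      \<open>Q n\<close>, and its padding agrees with \<open>w x\<close> on the inspected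
      entries.\<close>
    then have "x \<in> A (p x (m n))" using branch by (auto simp: H_def)
    then have "Q n x (pad (p x (m n)))" by (simp add: A_def len)
    moreover have "Q n x (pad (p x (m n))) = Q n x (w x)"
      by (rule m) (simp add: pad_def len p_nth)
    ultimately show "Q n x (w x)" by simp
  qed (use H_sets w_meas in auto)
qed

section \<open>Measurable sets in the product with Baire space as projections of closed sets\<close>

definition finitary2 :: "'a measure \<Rightarrow> ('a \<Rightarrow> (nat \<Rightarrow> nat) \<Rightarrow> (nat \<Rightarrow> nat) \<Rightarrow> bool) \<Rightarrow> bool" where
  "finitary2 M Q \<longleftrightarrow> (\<forall>\<sigma> \<tau>. {x \<in> space M. Q x \<sigma> \<tau>} \<in> sets M) \<and>
     (\<exists>m. \<forall>\<sigma> \<sigma>' \<tau> \<tau>'. (\<forall>i<m. \<sigma> i = \<sigma>' i \<and> \<tau> i = \<tau>' i) \<longrightarrow> (\<forall>x. Q x \<sigma> \<tau> = Q x \<sigma>' \<tau>'))"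

lemma finitary2E:
  assumes "finitary2 M Q"
  obtains m where "\<And>\<sigma> \<sigma>' \<tau> \<tau>' x. (\<And>l. l < m \<Longrightarrow> \<sigma> l = \<sigma>' l \<and> \<tau> l = \<tau>' l)
    \<Longrightarrow> Q x \<sigma> \<tau> = Q x \<sigma>' \<tau>'"
proof -
  obtain m where m: "\<forall>\<sigma> \<sigma>' \<tau> \<tau>'. (\<forall>i<m. \<sigma> i = \<sigma>' i \<and> \<tau> i = \<tau>' i) \<longrightarrow>
      (\<forall>x. Q x \<sigma> \<tau> = Q x \<sigma>' \<tau>')"
    using assms unfolding finitary2_def by blast
  show ?thesis
  proof (rule that[of m])
    fix \<sigma> \<sigma>' \<tau> \<tau>' :: "nat \<Rightarrow> nat" and x assume "\<And>l. l < m \<Longrightarrow> \<sigma> l = \<sigma>' l \<and> \<tau> l = \<tau>' l"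
    then have "\<forall>i<m. \<sigma> i = \<sigma>' i \<and> \<tau> i = \<tau>' i" by blast
    with m[rule_format, of \<sigma> \<sigma>' \<tau> \<tau>' x] show "Q x \<sigma> \<tau> = Q x \<sigma>' \<tau>'" by blast
  qed
qed

text \<open>
  The sets in the product with Baire space that are projections of closed sets, where closed means
  closed in the Baire coordinates with measurable sections.
\<close>

definition suslin :: "'a measure \<Rightarrow> ('a \<Rightarrow> (nat \<Rightarrow> nat) \<Rightarrow> bool) \<Rightarrow> bool" where
  "suslin M P \<longleftrightarrow> (\<exists>Q. (\<forall>n::nat. finitary2 M (Q n)) \<and>
     (\<forall>x\<in>space M. \<forall>\<sigma>. P x \<sigma> \<longleftrightarrow> (\<exists>\<tau>. \<forall>n. Q n x \<sigma> \<tau>)))"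

lemma suslin_finitary:
  assumes "finitary M P" shows "suslin M P"
proof -
  have "\<exists>m. \<forall>\<sigma> \<sigma>' \<tau> \<tau>'. (\<forall>i<m. \<sigma> i = \<sigma>' i \<and> \<tau> i = \<tau>' i) \<longrightarrow> (\<forall>x. P x \<sigma> = P x \<sigma>')"
    using assms unfolding finitary_def by (elim conjE exE) (rule exI, blast)
  then have "finitary2 M (\<lambda>x \<sigma> \<tau>. P x \<sigma>)"
    using assms unfolding finitary_def finitary2_def by blast
  then show ?thesis
    unfolding suslin_def by (intro exI[of _ "\<lambda>_ x \<sigma> \<tau>. P x \<sigma>"]) auto
qed

lemma suslin_cong:
  "(\<And>x \<sigma>. x \<in> space M \<Longrightarrow> P x \<sigma> = P' x \<sigma>) \<Longrightarrow> suslin M P = suslin M P'"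
  unfolding suslin_def by simp

text \<open>The first entry of the witness names the index \<open>i\<close> and the rest is a
  witness for \<open>P i\<close>. The condition coded by \<open>(i, n)\<close> is vacuous unless
  \<open>i\<close> is the index named.\<close>

lemma suslin_Ex:
  assumes "\<And>i::nat. suslin M (P i)"
  shows "suslin M (\<lambda>x \<sigma>. \<exists>i. P i x \<sigma>)"
proof -
  obtain Q where Q: "\<And>i n. finitary2 M (Q i n)"
    "\<And>i x \<sigma>. x \<in> space M \<Longrightarrow> P i x \<sigma> \<longleftrightarrow> (\<exists>\<tau>. \<forall>n::nat. Q i n x \<sigma> \<tau>)"
    using assms unfolding suslin_def by metis
  define Q' where "Q' j x \<sigma> \<tau> =
    (case prod_decode j of (i, n) \<Rightarrow> \<tau> 0 = i \<longrightarrow> Q i n x \<sigma> (\<lambda>l. \<tau> (Suc l)))" for j x \<sigma> \<tau>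
  have "finitary2 M (Q' j)" for j
  proof -
    obtain i n where j: "prod_decode j = (i, n)" by fastforce
    obtain m where m: "\<And>\<sigma> \<sigma>' \<tau> \<tau>' x. (\<And>l. l < m \<Longrightarrow> \<sigma> l = \<sigma>' l \<and> \<tau> l = \<tau>' l)
        \<Longrightarrow> Q i n x \<sigma> \<tau> = Q i n x \<sigma>' \<tau>'"
      by (rule finitary2E[OF Q(1)[of i n]]) blast
    have "{x \<in> space M. Q' j x \<sigma> \<tau>} \<in> sets M" for \<sigma> \<tau>
      using Q(1)[of i n] unfolding finitary2_def Q'_def j by (cases "\<tau> 0 = i") auto
    moreover have "Q' j x \<sigma> \<tau> = Q' j x \<sigma>' \<tau>'"
      if "\<forall>l<Suc m. \<sigma> l = \<sigma>' l \<and> \<tau> l = \<tau>' l" for x \<sigma> \<sigma>' \<tau> \<tau>'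
    proof -
      have "Q i n x \<sigma> (\<lambda>l. \<tau> (Suc l)) = Q i n x \<sigma>' (\<lambda>l. \<tau>' (Suc l))"
        by (rule m) (use that in auto)
      then show ?thesis using that unfolding Q'_def j by auto
    qed
    ultimately show ?thesis unfolding finitary2_def by blast
  qed
  moreover have "(\<exists>i. P i x \<sigma>) \<longleftrightarrow> (\<exists>\<tau>. \<forall>j. Q' j x \<sigma> \<tau>)" if x: "x \<in> space M" for x \<sigma>
  proof
    assume "\<exists>i. P i x \<sigma>"
    then obtain i \<tau> where "\<forall>n. Q i n x \<sigma> \<tau>" using Q(2)[OF x] by blast
    then have "\<forall>j. Q' j x \<sigma> (case_nat i \<tau>)" by (auto simp: Q'_def split: prod.split)
    then show "\<exists>\<tau>. \<forall>j. Q' j x \<sigma> \<tau>" by blast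
  next
    assume "\<exists>\<tau>. \<forall>j. Q' j x \<sigma> \<tau>"
    then obtain \<tau> where \<tau>: "\<And>j. Q' j x \<sigma> \<tau>" by blast
    have "Q (\<tau> 0) n x \<sigma> (\<lambda>l. \<tau> (Suc l))" for n
      using \<tau>[of "prod_encode (\<tau> 0, n)"] by (simp add: Q'_def)
    then show "\<exists>i. P i x \<sigma>" using Q(2)[OF x] by blast
  qed
  ultimately show ?thesis unfolding suslin_def by blast
qed

text \<open>One witness packs countably many: its entries at the positions
  \<open>prod_encode (i, l)\<close> form the witness for \<open>P i\<close>.\<close>

lemma suslin_All:
  assumes "\<And>i::nat. suslin M (P i)"
  shows "suslin M (\<lambda>x \<sigma>. \<forall>i. P i x \<sigma>)"
proof -
  obtain Q where Q: "\<And>i n. finitary2 M (Q i n)"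
    "\<And>i x \<sigma>. x \<in> space M \<Longrightarrow> P i x \<sigma> \<longleftrightarrow> (\<exists>\<tau>. \<forall>n::nat. Q i n x \<sigma> \<tau>)"
    using assms unfolding suslin_def by metis
  define Q' where "Q' j x \<sigma> \<tau> =
    (case prod_decode j of (i, n) \<Rightarrow> Q i n x \<sigma> (\<lambda>l. \<tau> (prod_encode (i, l))))" for j x \<sigma> \<tau>
  have "finitary2 M (Q' j)" for j
  proof -
    obtain i n where j: "prod_decode j = (i, n)" by fastforce
    obtain m where m: "\<And>\<sigma> \<sigma>' \<tau> \<tau>' x. (\<And>l. l < m \<Longrightarrow> \<sigma> l = \<sigma>' l \<and> \<tau> l = \<tau>' l)
        \<Longrightarrow> Q i n x \<sigma> \<tau> = Q i n x \<sigma>' \<tau>'"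
      by (rule finitary2E[OF Q(1)[of i n]]) blast
    have "{x \<in> space M. Q' j x \<sigma> \<tau>} \<in> sets M" for \<sigma> \<tau>
      using Q(1)[of i n] unfolding finitary2_def Q'_def j by auto
    \<comment> \<open>\<open>m'\<close> bounds the first \<open>m\<close> entries of
      \<open>\<sigma>\<close> as well as the scattered positions at which the first \<open>m\<close>
      entries of the packed witness for \<open>P i\<close> are stored.\<close>
    moreover define m' where "m' = m + (\<Sum>l<m. Suc (prod_encode (i, l)))"
    have m'_gt: "prod_encode (i, l) < m'" if "l < m" for l
      using member_le_sum[of l "{..<m}" "\<lambda>l. Suc (prod_encode (i, l))"] that
      by (simp add: m'_def)
    have "Q' j x \<sigma> \<tau> = Q' j x \<sigma>' \<tau>'"
      if "\<forall>l<m'. \<sigma> l = \<sigma>' l \<and> \<tau> l = \<tau>' l" for x \<sigma> \<sigma>' \<tau> \<tau>'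
      unfolding Q'_def j prod.case
      by (rule m) (use that m'_gt in \<open>auto simp: m'_def\<close>)
    ultimately show ?thesis unfolding finitary2_def by blast
  qed
  moreover have "(\<forall>i. P i x \<sigma>) \<longleftrightarrow> (\<exists>\<tau>. \<forall>j. Q' j x \<sigma> \<tau>)" if x: "x \<in> space M" for x \<sigma>
  proof
    assume "\<forall>i. P i x \<sigma>"
    then have "\<forall>i. \<exists>\<tau>. \<forall>n. Q i n x \<sigma> \<tau>" using Q(2)[OF x] by blast
    then obtain \<tau> where "\<forall>i n. Q i n x \<sigma> (\<tau> i)" using choice by meson
    then have "\<forall>j. Q' j x \<sigma> (\<lambda>l. case prod_decode l of (i, l) \<Rightarrow> \<tau> i l)"
      by (auto simp: Q'_def split: prod.split)
    then show "\<exists>\<tau>. \<forall>j. Q' j x \<sigma> \<tau>" by blast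
  next
    assume "\<exists>\<tau>. \<forall>j. Q' j x \<sigma> \<tau>"
    then obtain \<tau> where \<tau>: "\<And>j. Q' j x \<sigma> \<tau>" by blast
    have "Q i n x \<sigma> (\<lambda>l. \<tau> (prod_encode (i, l)))" for i n
      using \<tau>[of "prod_encode (i, n)"] by (simp add: Q'_def)
    then show "\<forall>i. P i x \<sigma>" using Q(2)[OF x] by blast
  qed
  ultimately show ?thesis unfolding suslin_def by blast
qed

text \<open>The Suslin class is not closed under complement in general, so the induction runs over
  sets for which both the set and its complement are Suslin. Closure under countable unions then
  uses \<open>suslin_Ex\<close> for the set and \<open>suslin_All\<close> for the
  complement.\<close>

lemma suslin_sets:
  assumes "B \<in> sets (M \<Otimes>\<^sub>M baire)"
  shows "suslin M (\<lambda>x \<sigma>. (x, \<sigma>) \<in> B)"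
proof -
  define \<G> where "\<G> = {B. B \<subseteq> space M \<times> (UNIV :: (nat \<Rightarrow> nat) set) \<and>
    suslin M (\<lambda>x \<sigma>. (x, \<sigma>) \<in> B) \<and> suslin M (\<lambda>x \<sigma>. (x, \<sigma>) \<notin> B)}"
  have "sigma_algebra (space M \<times> UNIV) \<G>"
    unfolding sigma_algebra_iff2
  proof (intro conjI ballI allI impI)
    show "\<G> \<subseteq> Pow (space M \<times> UNIV)" by (auto simp: \<G>_def)
    show "{} \<in> \<G>" by (auto simp: \<G>_def finitary_def intro!: suslin_finitary)
    show "space M \<times> UNIV - B \<in> \<G>" if "B \<in> \<G>" for B
      using that unfolding \<G>_def by (auto cong: suslin_cong)
    show "(\<Union>i::nat. B i) \<in> \<G>" if "range B \<subseteq> \<G>" for B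
      using that unfolding \<G>_def by (auto intro!: suslin_Ex suslin_All simp: image_subset_iff)
  qed
  then have sets_N: "sets (sigma (space M \<times> UNIV) \<G>) = \<G>"
    by (rule sigma_algebra.sets_measure_of_eq)
  have space_N: "space (sigma (space M \<times> UNIV) \<G>) = space M \<times> UNIV"
    by (rule space_measure_of) (auto simp: \<G>_def)
  \<comment> \<open>Measurability of the identity is the inclusion of the product sigma-algebra in
    \<open>\<G>\<close>; it reduces to cylinders over measurable sets and over single Baire
    coordinates.\<close>
  have "(\<lambda>z. z) \<in> sigma (space M \<times> UNIV) \<G> \<rightarrow>\<^sub>M M \<Otimes>\<^sub>M baire"
  proof (rule measurable_pair)
    show "fst \<circ> (\<lambda>z. z) \<in> sigma (space M \<times> UNIV) \<G> \<rightarrow>\<^sub>M M"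
    proof (rule measurableI)
      fix A assume A: "A \<in> sets M"
      then have "A \<times> UNIV \<in> \<G>"
        unfolding \<G>_def using sets.sets_into_space[OF A]
        by (auto intro!: suslin_finitary simp: finitary_def Int_def[symmetric] Diff_eq[symmetric] set_diff_eq[symmetric]
            Collect_conj_eq)
      moreover have "(fst \<circ> (\<lambda>z. z)) -` A \<inter> space M \<times> (UNIV :: (nat \<Rightarrow> nat) set) = A \<times> UNIV"
        using sets.sets_into_space[OF A] by auto
      ultimately show "(fst \<circ> (\<lambda>z. z)) -` A \<inter> space (sigma (space M \<times> UNIV) \<G>)
          \<in> sets (sigma (space M \<times> UNIV) \<G>)"
        unfolding sets_N space_N by (simp only:)
    qed (auto simp: space_N)
    show "snd \<circ> (\<lambda>z. z) \<in> sigma (space M \<times> UNIV) \<G> \<rightarrow>\<^sub>M baire"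
    proof (rule measurable_baireI, rule measurableI)
      fix i and K :: "nat set"
      \<comment> \<open>Deciding coordinate \<open>i\<close> requires the first \<open>Suc i\<close>
        entries.\<close>
      have "(\<lambda>z. (snd \<circ> (\<lambda>z. z)) z i) -` K \<inter> space M \<times> UNIV \<in> \<G>"
        unfolding \<G>_def
        by (auto intro!: suslin_finitary exI[of _ "Suc i"] simp: finitary_def cong: suslin_cong)
      then show "(\<lambda>z. (snd \<circ> (\<lambda>z. z)) z i) -` K \<inter> space (sigma (space M \<times> UNIV) \<G>)
          \<in> sets (sigma (space M \<times> UNIV) \<G>)"
        unfolding sets_N space_N by (simp only:)
    qed auto
  qed
  from measurable_sets[OF this assms] have "B \<in> \<G>"
    using sets.sets_into_space[OF assms] by (simp add: sets_N space_N space_pair_measure Int_absorb2)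
  then show ?thesis by (simp add: \<G>_def)
qed

text \<open>A branch is made to carry both the solution \<open>\<sigma>\<close> and its Suslin
  witness \<open>\<tau>\<close>, so branch selection finds the two together. \<open>D\<close> and
  \<open>H\<close> enclose the projection of \<open>B\<close> and differ by a null set, so the
  projection is measurable for the completion.\<close>

lemma measurable_selection_baire:
  assumes "finite_measure M" and B: "B \<in> sets (M \<Otimes>\<^sub>M baire)"
  obtains D H w where "D \<in> sets M" "H \<in> sets M" "H - D \<in> null_sets M"
    "{x. \<exists>\<sigma>. (x, \<sigma>) \<in> B} \<subseteq> H" "w \<in> M \<rightarrow>\<^sub>M baire" "\<And>x. x \<in> D \<Longrightarrow> (x, w x) \<in> B"
proof -
  obtain Q where Q: "\<And>n. finitary2 M (Q n)"
    "\<And>x \<sigma>. x \<in> space M \<Longrightarrow> (x, \<sigma>) \<in> B \<longleftrightarrow> (\<exists>\<tau>. \<forall>n::nat. Q n x \<sigma> \<tau>)"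
    using suslin_sets[OF B] unfolding suslin_def by blast
  \<comment> \<open>Decoding entry by entry keeps conditions finitary: the first \<open>m\<close>
    entries of \<open>\<omega>\<close> determine the first \<open>m\<close> of both halves.\<close>
  define l r where "l \<omega> i = fst (prod_decode (\<omega> i))" and "r \<omega> i = snd (prod_decode (\<omega> i))"
    for \<omega> :: "nat \<Rightarrow> nat" and i
  have lr: "\<exists>\<omega>. l \<omega> = \<sigma> \<and> r \<omega> = \<tau>" for \<sigma> \<tau>
    by (rule exI[of _ "\<lambda>i. prod_encode (\<sigma> i, \<tau> i)"]) (auto simp: l_def r_def)
  have "finitary M (\<lambda>x \<omega>. Q n x (l \<omega>) (r \<omega>))" for n
  proof -
    obtain m where m: "\<And>\<sigma> \<sigma>' \<tau> \<tau>' x. (\<And>l. l < m \<Longrightarrow> \<sigma> l = \<sigma>' l \<and> \<tau> l = \<tau>' l)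
        \<Longrightarrow> Q n x \<sigma> \<tau> = Q n x \<sigma>' \<tau>'"
      by (rule finitary2E[OF Q(1)[of n]]) blast
    have "Q n x (l \<omega>) (r \<omega>) = Q n x (l \<omega>') (r \<omega>')" if "\<forall>i<m. \<omega> i = \<omega>' i" for x \<omega> \<omega>'
      by (rule m) (use that in \<open>simp add: l_def r_def\<close>)
    then show ?thesis using Q(1)[of n] unfolding finitary_def finitary2_def by blast
  qed
  then obtain D H w where *: "D \<in> sets M" "H \<in> sets M" "H - D \<in> null_sets M"
    "{x \<in> space M. \<exists>\<omega>. \<forall>n. Q n x (l \<omega>) (r \<omega>)} \<subseteq> H" "w \<in> M \<rightarrow>\<^sub>M baire"
    "\<And>x n. x \<in> D \<Longrightarrow> Q n x (l (w x)) (r (w x))"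
    by (rule finitary_branch_selection[OF assms(1), of "\<lambda>n x \<omega>. Q n x (l \<omega>) (r \<omega>)"]) blast
  show ?thesis
  proof (rule that)
    show "{x. \<exists>\<sigma>. (x, \<sigma>) \<in> B} \<subseteq> H"
    proof safe
      fix x \<sigma> assume xs: "(x, \<sigma>) \<in> B"
      then have x: "x \<in> space M" using sets.sets_into_space[OF B] by (auto simp: space_pair_measure)
      then obtain \<tau> where "\<forall>n. Q n x \<sigma> \<tau>" using Q(2) xs by blast
      then show "x \<in> H" using *(4) x lr[of \<sigma> \<tau>] by blast
    qed
    show "(\<lambda>x. l (w x)) \<in> M \<rightarrow>\<^sub>M baire"
    proof (rule measurable_baireI)
      have "(\<lambda>x. w x i) \<in> M \<rightarrow>\<^sub>M count_space UNIV" for i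
        by (rule measurable_compose[OF *(5) measurable_baire_component])
      then show "(\<lambda>x. l (w x) i) \<in> M \<rightarrow>\<^sub>M count_space UNIV" for i
        unfolding l_def by (rule measurable_compose[where g = "\<lambda>j. fst (prod_decode j)"]) simp
    qed
    show "(x, l (w x)) \<in> B" if "x \<in> D" for x
      using *(6)[OF that] Q(2) sets.sets_into_space[OF *(1)] that by blast
  qed (use * in auto)
qed

subsection \<open>Lower semianalytic functions\<close>

text \<open>The representation by a partial infimum, rather than analyticity of the sublevel sets,
  is the definition, because it is what the recursion reproduces and what the selection acts
  on.\<close>

definition lower_semianalytic :: "'a measure \<Rightarrow> ('a \<Rightarrow> ennreal) \<Rightarrow> bool" where
  "lower_semianalytic M j \<longleftrightarrow>
     (\<exists>G \<in> borel_measurable (M \<Otimes>\<^sub>M baire). \<forall>x\<in>space M. j x = (INF \<sigma>. G (x, \<sigma>)))"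

lemma INF_const_add_ennreal:
  fixes c :: ennreal shows "(INF i\<in>I. c + F i) = c + (INF i\<in>I. F i)"
proof (cases "c = top")
  case False
  show ?thesis
  proof (rule antisym)
    have "(INF i\<in>I. c + F i) - c \<le> (INF i\<in>I. F i)"
    proof (rule INF_greatest)
      show "(INF i\<in>I. c + F i) - c \<le> F i" if "i \<in> I" for i
        using that False by (auto simp: ennreal_minus_le_iff intro: INF_lower)
    qed
    then show "(INF i\<in>I. c + F i) \<le> c + (INF i\<in>I. F i)"
      unfolding ennreal_minus_le_iff by (rule conjunct1)
  qed (auto intro!: INF_greatest add_left_mono INF_lower)
qed (cases "I = {}", simp_all)

text \<open>
  The sets where the infimum is smaller than \<open>a\<close> are projections of measurable sets, hence
  measurable for the completion.
\<close>

lemma INF_measurable_version: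
  fixes G :: "'a \<times> (nat \<Rightarrow> nat) \<Rightarrow> ennreal"
  assumes "finite_measure M" and G: "G \<in> borel_measurable (M \<Otimes>\<^sub>M baire)"
  shows "\<exists>J\<in>borel_measurable M. AE x in M. (INF \<sigma>. G (x, \<sigma>)) = J x"
proof -
  have "(\<lambda>x. INF \<sigma>. G (x, \<sigma>)) \<in> borel_measurable (completion M)"
  proof (rule borel_measurableI_less)
    fix a :: ennreal
    let ?B = "{z \<in> space (M \<Otimes>\<^sub>M baire). G z < a}" and ?E = "{x \<in> space M. (INF \<sigma>. G (x, \<sigma>)) < a}"
    have B: "?B \<in> sets (M \<Otimes>\<^sub>M baire)" using G by measurable
    obtain D H w where DH: "D \<in> sets M" "H \<in> sets M" "H - D \<in> null_sets M"
      "{x. \<exists>\<sigma>. (x, \<sigma>) \<in> ?B} \<subseteq> H" "w \<in> M \<rightarrow>\<^sub>M baire" "\<And>x. x \<in> D \<Longrightarrow> (x, w x) \<in> ?B"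
      by (rule measurable_selection_baire[OF assms(1) B]) blast
    have "?E = {x. \<exists>\<sigma>. (x, \<sigma>) \<in> ?B}" by (auto simp: INF_less_iff space_pair_measure)
    then have "D \<subseteq> ?E" "?E \<subseteq> H" using DH(4,6) by blast+
    then have "?E = D \<union> (?E - D)" "?E - D \<subseteq> H - D" by auto
    then have "?E \<in> sets (completion M)"
      by (rule sets_completionI[OF _ _ DH(3,1)])
    then show "{x \<in> space (completion M). (INF \<sigma>. G (x, \<sigma>)) < a} \<in> sets (completion M)"
      by simp
  qed
  then show ?thesis by (rule completion_ex_borel_measurable)
qed

text \<open>The measure is separate from the sigma-algebra \<open>M\<close> of the representation:
  the same \<open>j\<close> is used with many measures, each with its own Borel version.\<close>

lemma lower_semianalytic_version:
  assumes "lower_semianalytic M j" "finite_measure \<mu>" "sets \<mu> = sets M"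
  shows "\<exists>J\<in>borel_measurable \<mu>. AE x in \<mu>. j x = J x"
proof -
  obtain G where G: "G \<in> borel_measurable (M \<Otimes>\<^sub>M baire)"
    "\<And>x. x \<in> space M \<Longrightarrow> j x = (INF \<sigma>. G (x, \<sigma>))"
    using assms(1) unfolding lower_semianalytic_def by blast
  have "sets (\<mu> \<Otimes>\<^sub>M baire) = sets (M \<Otimes>\<^sub>M baire)"
    by (rule sets_pair_measure_cong) (simp_all add: assms(3))
  then have "G \<in> borel_measurable (\<mu> \<Otimes>\<^sub>M baire)"
    using G(1) measurable_cong_sets by blast
  then obtain J where J: "J \<in> borel_measurable \<mu>" "AE x in \<mu>. (INF \<sigma>. G (x, \<sigma>)) = J x"
    using INF_measurable_version[OF assms(2)] by blast
  have "AE x in \<mu>. j x = J x"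
    using J(2) AE_space by eventually_elim (use G(2) sets_eq_imp_space_eq[OF assms(3)] in auto)
  with J(1) show ?thesis by blast
qed

text \<open>The infimum is replaced by its Borel version \<open>J\<close> to make the set of
  near-minimisers measurable. Since \<open>\<epsilon>\<close> is positive, almost every section of
  that set is nonempty, so almost every point lies in \<open>H\<close>, and then in
  \<open>D\<close>.\<close>

lemma INF_eps_selection:
  fixes G :: "'a \<times> (nat \<Rightarrow> nat) \<Rightarrow> ennreal"
  assumes "finite_measure M" and G: "G \<in> borel_measurable (M \<Otimes>\<^sub>M baire)" and "(\<epsilon>::real) > 0"
  obtains w where "w \<in> M \<rightarrow>\<^sub>M baire" "AE x in M. G (x, w x) \<le> (INF \<sigma>. G (x, \<sigma>)) + ennreal \<epsilon>"
proof -
  obtain J where J: "J \<in> borel_measurable M" "AE x in M. (INF \<sigma>. G (x, \<sigma>)) = J x"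
    using INF_measurable_version[OF assms(1,2)] by blast
  let ?B = "{z \<in> space (M \<Otimes>\<^sub>M baire). G z \<le> J (fst z) + ennreal \<epsilon>}"
  have B: "?B \<in> sets (M \<Otimes>\<^sub>M baire)" using G J(1) by measurable
  obtain D H w where DH: "D \<in> sets M" "H \<in> sets M" "H - D \<in> null_sets M"
    "{x. \<exists>\<sigma>. (x, \<sigma>) \<in> ?B} \<subseteq> H" "w \<in> M \<rightarrow>\<^sub>M baire" "\<And>x. x \<in> D \<Longrightarrow> (x, w x) \<in> ?B"
    by (rule measurable_selection_baire[OF assms(1) B]) blast
  have "AE x in M. G (x, w x) \<le> (INF \<sigma>. G (x, \<sigma>)) + ennreal \<epsilon>"
    using J(2) AE_not_in[OF DH(3)] AE_space
  proof eventually_elim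
    case (elim x)
    have "\<exists>\<sigma>. G (x, \<sigma>) \<le> J x + ennreal \<epsilon>"
    proof (cases "J x = top")
      case False
      then have "(INF \<sigma>. G (x, \<sigma>)) < J x + ennreal \<epsilon>"
        using elim(1) assms(3) by (cases "J x") (auto simp flip: ennreal_plus simp: ennreal_less_iff)
      then show ?thesis unfolding INF_less_iff by (auto intro: less_imp_le)
    qed auto
    then have "x \<in> H" using DH(4) elim(3) by (auto simp: space_pair_measure)
    then have "(x, w x) \<in> ?B" using elim(2) DH(6) by blast
    then show ?case using elim(1) by simp
  qed
  with DH(5) show ?thesis by (rule that)
qed

lemma lower_semianalytic_compose:
  assumes "lower_semianalytic M j" "h \<in> L \<rightarrow>\<^sub>M M"
  shows "lower_semianalytic L (\<lambda>x. j (h x))"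
proof -
  obtain G where [measurable]: "G \<in> borel_measurable (M \<Otimes>\<^sub>M baire)"
    and G: "\<And>x. x \<in> space M \<Longrightarrow> j x = (INF \<sigma>. G (x, \<sigma>))"
    using assms(1) unfolding lower_semianalytic_def by blast
  note assms(2)[measurable]
  have "(\<lambda>z. G (h (fst z), snd z)) \<in> borel_measurable (L \<Otimes>\<^sub>M baire)" by measurable
  moreover have "\<forall>x\<in>space L. j (h x) = (INF \<sigma>. G (h (fst (x, \<sigma>)), snd (x, \<sigma>)))"
    using G measurable_space[OF assms(2)] by simp
  ultimately show ?thesis unfolding lower_semianalytic_def
    by (intro bexI[of _ "\<lambda>z. G (h (fst z), snd z)"])
qed

lemma lower_semianalytic_measurable:
  assumes "j \<in> borel_measurable M" shows "lower_semianalytic M j"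
  unfolding lower_semianalytic_def
  by (rule bexI[of _ "\<lambda>z. j (fst z)"]) (use assms in \<open>auto intro!: measurable_compose[OF measurable_fst]\<close>)

lemma lower_semianalytic_add:
  assumes "lower_semianalytic M j" and [measurable]: "c \<in> borel_measurable M"
  shows "lower_semianalytic M (\<lambda>x. c x + j x)"
proof -
  obtain G where [measurable]: "G \<in> borel_measurable (M \<Otimes>\<^sub>M baire)"
    and G: "\<And>x. x \<in> space M \<Longrightarrow> j x = (INF \<sigma>. G (x, \<sigma>))"
    using assms(1) unfolding lower_semianalytic_def by blast
  have "(\<lambda>z. c (fst z) + G z) \<in> borel_measurable (M \<Otimes>\<^sub>M baire)" by measurable
  moreover have "\<forall>x\<in>space M. c x + j x = (INF \<sigma>. c (fst (x, \<sigma>)) + G (x, \<sigma>))"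
    using G by (simp add: INF_const_add_ennreal)
  ultimately show ?thesis unfolding lower_semianalytic_def
    by (intro bexI[of _ "\<lambda>z. c (fst z) + G z"])
qed

text \<open>Writing inputs as values of \<open>\<phi>\<close> turns the infimum over
  \<open>V\<close> into one over Baire space. Together with the infimum that represents
  \<open>b\<close> it becomes a single infimum over interleaved sequences, whose near-minimisers
  contain a near-optimal input.\<close>

lemma lower_semianalytic_INF_selection:
  assumes b: "lower_semianalytic (M \<Otimes>\<^sub>M V) b"
    and \<phi>: "\<phi> \<in> baire \<rightarrow>\<^sub>M V" "range \<phi> = space V"
  shows lower_semianalytic_INF: "lower_semianalytic M (\<lambda>x. INF u\<in>space V. b (x, u))"
    and lower_semianalytic_eps_selection:
      "\<And>\<mu> \<epsilon>::real. finite_measure \<mu> \<Longrightarrow> sets \<mu> = sets M \<Longrightarrow> \<epsilon> > 0 \<Longrightarrow> \<exists>u\<in>M \<rightarrow>\<^sub>M V.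
         AE x in \<mu>. b (x, u x) \<le> (INF u\<in>space V. b (x, u)) + ennreal \<epsilon>"
proof -
  obtain G where [measurable]: "G \<in> borel_measurable ((M \<Otimes>\<^sub>M V) \<Otimes>\<^sub>M baire)"
    and G: "\<And>z. z \<in> space (M \<Otimes>\<^sub>M V) \<Longrightarrow> b z = (INF \<sigma>. G (z, \<sigma>))"
    using b unfolding lower_semianalytic_def by blast
  note \<phi>(1)[measurable]
  \<comment> \<open>Even positions code the input, odd ones the parameter that represents
    \<open>b\<close>.\<close>
  define l r where "l \<omega> i = \<omega> (2 * i)" and "r \<omega> i = \<omega> (2 * i + 1)" for \<omega> :: "nat \<Rightarrow> nat" and i
  have [measurable]: "l \<in> baire \<rightarrow>\<^sub>M baire" "r \<in> baire \<rightarrow>\<^sub>M baire"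
    by (auto intro!: measurable_baireI simp: l_def r_def)
  have lr: "\<exists>\<omega>. l \<omega> = \<sigma> \<and> r \<omega> = \<tau>" for \<sigma> \<tau>
    by (rule exI[of _ "\<lambda>i. if even i then \<sigma> (i div 2) else \<tau> (i div 2)"]) (auto simp: l_def r_def)
  define G' where "G' z = G ((fst z, \<phi> (l (snd z))), r (snd z))" for z
  have G'_meas: "G' \<in> borel_measurable (M \<Otimes>\<^sub>M baire)" unfolding G'_def by measurable
  have V: "\<phi> \<sigma> \<in> space V" for \<sigma> using \<phi>(2) by blast
  have INF_eq: "(INF u\<in>space V. b (x, u)) = (INF \<omega>. G' (x, \<omega>))" if x: "x \<in> space M" for x
  proof (rule antisym)
    show "(INF u\<in>space V. b (x, u)) \<le> (INF \<omega>. G' (x, \<omega>))"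
    proof (rule INF_greatest)
      fix \<omega>
      have "(INF u\<in>space V. b (x, u)) \<le> b (x, \<phi> (l \<omega>))" by (rule INF_lower) (rule V)
      also have "\<dots> \<le> G' (x, \<omega>)"
        using x V by (auto simp: G space_pair_measure G'_def intro: INF_lower)
      finally show "(INF u\<in>space V. b (x, u)) \<le> G' (x, \<omega>)" .
    qed
    show "(INF \<omega>. G' (x, \<omega>)) \<le> (INF u\<in>space V. b (x, u))"
    proof (rule INF_greatest)
      fix u assume u: "u \<in> space V"
      then obtain \<sigma> where \<sigma>: "u = \<phi> \<sigma>" using \<phi>(2) by blast
      have "(INF \<omega>. G' (x, \<omega>)) \<le> G ((x, u), \<tau>)" for \<tau>
      proof -
        obtain \<omega> where "l \<omega> = \<sigma>" "r \<omega> = \<tau>" using lr by blast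
        then show ?thesis by (intro INF_lower2[of \<omega>]) (auto simp: G'_def \<sigma>)
      qed
      then show "(INF \<omega>. G' (x, \<omega>)) \<le> b (x, u)"
        using x u by (simp add: G space_pair_measure INF_greatest)
    qed
  qed
  show "lower_semianalytic M (\<lambda>x. INF u\<in>space V. b (x, u))"
    unfolding lower_semianalytic_def using INF_eq G'_meas by blast
  fix \<mu> :: "'a measure" and \<epsilon> :: real
  assume \<mu>: "finite_measure \<mu>" "sets \<mu> = sets M" "\<epsilon> > 0"
  have "sets (\<mu> \<Otimes>\<^sub>M baire) = sets (M \<Otimes>\<^sub>M baire)"
    by (rule sets_pair_measure_cong) (simp_all add: \<mu>(2))
  then have "G' \<in> borel_measurable (\<mu> \<Otimes>\<^sub>M baire)"
    using G'_meas measurable_cong_sets by blast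
  then obtain w where w: "w \<in> \<mu> \<rightarrow>\<^sub>M baire" "AE x in \<mu>. G' (x, w x) \<le> (INF \<sigma>. G' (x, \<sigma>)) + ennreal \<epsilon>"
    by (rule INF_eps_selection[OF \<mu>(1) _ \<mu>(3)])
  have sp: "space \<mu> = space M" using \<mu>(2) by (rule sets_eq_imp_space_eq)
  show "\<exists>u\<in>M \<rightarrow>\<^sub>M V. AE x in \<mu>. b (x, u x) \<le> (INF u\<in>space V. b (x, u)) + ennreal \<epsilon>"
  proof (rule bexI)
    have [measurable]: "w \<in> M \<rightarrow>\<^sub>M baire" using w(1) measurable_cong_sets[OF \<mu>(2) refl] by blast
    show "(\<lambda>x. \<phi> (l (w x))) \<in> M \<rightarrow>\<^sub>M V" by measurable
    show "AE x in \<mu>. b (x, \<phi> (l (w x))) \<le> (INF u\<in>space V. b (x, u)) + ennreal \<epsilon>"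
      using w(2) AE_space
    proof eventually_elim
      case (elim x)
      \<comment> \<open>Only the input half of \<open>w x\<close> is kept; forgetting the other half
        cannot raise the value, as \<open>b\<close> is the infimum over it.\<close>
      then have "b (x, \<phi> (l (w x))) \<le> G' (x, w x)"
        using V by (auto simp: G sp space_pair_measure G'_def intro: INF_lower)
      also note elim(1)
      finally show ?case using INF_eq elim(2) sp by simp
    qed
  qed
qed

subsection \<open>Gluing along a map\<close>

text \<open>Digits 0 and 1 in base 3 leave a tail of at most 1/2 after shifting, so no carry can
  disturb the floor; in base 2 the tail could reach 1.\<close>

lemma ternary_digit:
  fixes b :: "nat \<Rightarrow> bool"
  defines "z \<equiv> \<Sum>k. of_bool (b k) * (1/3::real)^k"
  shows "\<lfloor>3^k * z\<rfloor> mod 3 = of_bool (b k)"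
proof -
  let ?f = "\<lambda>k. of_bool (b k) * (1/3::real)^k"
  have geo: "summable (\<lambda>k. (1/3::real)^k)" by (intro summable_geometric) simp
  have f: "summable ?f" by (rule summable_comparison_test'[OF geo, of 0]) simp
  have tail: "summable (\<lambda>i. ?f (i + Suc k))" using f by (subst summable_iff_shift)
  have geo_tail: "summable (\<lambda>i. (1/3::real)^(i + Suc k))" using geo by (subst summable_iff_shift)
  let ?r = "3^k * (\<Sum>i. ?f (i + Suc k))"
  have r0: "?r \<ge> 0" by (intro mult_nonneg_nonneg suminf_nonneg tail) auto
  have "(\<Sum>i. ?f (i + Suc k)) \<le> (\<Sum>i. (1/3)^(i + Suc k))"
    by (intro suminf_le tail geo_tail) auto
  also have "\<dots> = (\<Sum>i. (1/3)^i * (1/3)^Suc k)" by (simp only: power_add)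
  also have "\<dots> = (\<Sum>i. (1/3)^i) * (1/3::real)^Suc k"
    by (rule suminf_mult2[OF geo, symmetric])
  also have "\<dots> = 1/2 * (1/3)^k" by (simp add: suminf_geometric)
  finally have "?r \<le> 3^k * (1/2 * (1/3)^k)" by (intro mult_left_mono) auto
  also have "\<dots> = 1/2" by (simp add: power_one_over)
  finally have r1: "?r < 1" by simp
  \<comment> \<open>The digits before position \<open>k\<close> contribute \<open>3 * m\<close>,
    which vanishes modulo 3.\<close>
  define m :: int where "m = (\<Sum>i<k. of_bool (b i) * 3^(k - i - 1))"
  have "3^k * (\<Sum>i<k. ?f i) = 3 * real_of_int m"
    unfolding m_def of_int_sum sum_distrib_left
  proof (rule sum.cong)
    fix i assume "i \<in> {..<k}"
    then have "k = Suc (k - i - 1) + i" by simp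
    then have "(3::real)^k = 3 * 3^(k - i - 1) * 3^i" by (metis power_Suc power_add)
    then show "3^k * ?f i = 3 * of_int (of_bool (b i) * 3^(k - i - 1))"
      by (simp add: power_one_over)
  qed simp
  moreover have "3^k * ?f k = of_bool (b k)" by (simp add: power_one_over)
  moreover have "z = (\<Sum>i. ?f (i + Suc k)) + ((\<Sum>i<k. ?f i) + ?f k)"
    unfolding z_def using suminf_split_initial_segment[OF f, of "Suc k"] by simp
  ultimately have "3^k * z = of_int (3 * m + of_bool (b k)) + ?r"
    by (simp only: distrib_left) simp
  then have "\<lfloor>3^k * z\<rfloor> = 3 * m + of_bool (b k)"
    using r0 r1 by (intro floor_unique) auto
  then show ?thesis by simp
qed

text \<open>The graph of \<open>\<sigma>\<close> is a subset of pairs of naturals, and its indicator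
  is stored as a ternary expansion. The decoder finds \<open>\<sigma> n\<close> as the only
  \<open>m\<close> whose digit at \<open>(n, m)\<close> is 1.\<close>

lemma baire_real_coding:
  obtains \<zeta> :: "(nat \<Rightarrow> nat) \<Rightarrow> real" and \<beta>
  where "\<zeta> \<in> borel_measurable baire" "\<beta> \<in> borel \<rightarrow>\<^sub>M baire" "\<And>\<sigma>. \<beta> (\<zeta> \<sigma>) = \<sigma>"
proof
  let ?b = "\<lambda>\<sigma> k. \<sigma> (fst (prod_decode k)) = snd (prod_decode k)"
  let ?\<zeta> = "\<lambda>\<sigma>. \<Sum>k. of_bool (?b \<sigma> k) * (1/3::real)^k"
  let ?\<beta> = "\<lambda>(z::real) n. LEAST m. \<lfloor>3^prod_encode (n, m) * z\<rfloor> mod 3 = 1"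
  have "(\<lambda>\<sigma>. of_bool (?b \<sigma> k) * (1/3::real)^k) \<in> borel_measurable baire" for k
    by (rule measurable_compose[OF measurable_baire_component, where
          g = "\<lambda>j. of_bool (j = snd (prod_decode k)) * (1/3::real)^k"]) simp
  then show "?\<zeta> \<in> borel_measurable baire" by (rule borel_measurable_suminf)
  show "?\<beta> \<in> borel \<rightarrow>\<^sub>M baire"
    by (rule measurable_baireI) measurable
  show "?\<beta> (?\<zeta> \<sigma>) = \<sigma>" for \<sigma> :: "nat \<Rightarrow> nat"
  proof
    fix n
    have "(\<lfloor>3^prod_encode (n, m) * ?\<zeta> \<sigma>\<rfloor> mod 3 = 1) = (\<sigma> n = m)" for m
      by (subst ternary_digit) simp
    then have "?\<beta> (?\<zeta> \<sigma>) n = (LEAST m. \<sigma> n = m)" by presburger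
    also have "\<dots> = \<sigma> n" by (rule Least_equality) auto
    finally show "?\<beta> (?\<zeta> \<sigma>) n = \<sigma> n" .
  qed
qed

text \<open>On \<open>A\<close>, where \<open>g < f\<close>, the difference \<open>f - g\<close> has
  integral 0, so \<open>A\<close> is null. Finiteness of the integral of \<open>g\<close> makes the
  subtraction legitimate.\<close>

lemma AE_le_of_set_nn_integral_le:
  fixes f g :: "'a \<Rightarrow> ennreal"
  assumes [measurable]: "f \<in> borel_measurable M" "g \<in> borel_measurable M"
    and le: "\<And>A. A \<in> sets M \<Longrightarrow> (\<integral>\<^sup>+x\<in>A. f x \<partial>M) \<le> (\<integral>\<^sup>+x\<in>A. g x \<partial>M)"
    and fin: "(\<integral>\<^sup>+x. g x \<partial>M) \<noteq> \<infinity>"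
  shows "AE x in M. f x \<le> g x"
proof -
  define A where "A = {x \<in> space M. g x < f x}"
  have A[measurable]: "A \<in> sets M" unfolding A_def by measurable
  have "(\<integral>\<^sup>+x. g x * indicator A x \<partial>M) \<le> (\<integral>\<^sup>+x. g x \<partial>M)"
    by (rule nn_integral_mono) (simp add: indicator_def)
  then have finA: "(\<integral>\<^sup>+x. g x * indicator A x \<partial>M) \<noteq> \<infinity>" using fin by (auto simp: top_unique)
  have "(\<integral>\<^sup>+x. f x * indicator A x - g x * indicator A x \<partial>M)
      = (\<integral>\<^sup>+x\<in>A. f x \<partial>M) - (\<integral>\<^sup>+x\<in>A. g x \<partial>M)"
    by (rule nn_integral_diff) (use finA in \<open>auto simp: A_def indicator_def\<close>)
  also have "\<dots> = 0"
    using le_less_trans[OF le[OF A]] finA le[OF A] by (intro diff_eq_0_ennreal) (auto simp: less_top)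
  finally have "AE x in M. f x * indicator A x - g x * indicator A x = 0"
    by (subst (asm) nn_integral_0_iff_AE) auto
  then show ?thesis
    using AE_space
  proof eventually_elim
    case (elim x)
    then show ?case
      using ennreal_minus_eq_0[OF elim(1)] by (cases "x \<in> A") (auto simp: A_def not_less)
  qed
qed

text \<open>
  The Radon--Nikodym densities are monotone in \<open>q\<close> and at most 1 only almost everywhere; they are
  set to 0 on the exceptional null set.
\<close>

lemma conditional_cdf:
  fixes \<gamma> :: "('a \<times> ereal) measure"
  assumes "prob_space \<gamma>" and sets_\<gamma>: "sets \<gamma> = sets (\<nu> \<Otimes>\<^sub>M borel)" and \<nu>: "distr \<gamma> \<nu> fst = \<nu>"
  obtains F :: "rat \<Rightarrow> 'a \<Rightarrow> ennreal" where
    "\<And>q. F q \<in> borel_measurable \<nu>" "\<And>p q x. p \<le> q \<Longrightarrow> F p x \<le> F q x" "\<And>q x. F q x \<le> 1"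
    "\<And>q A. A \<in> sets \<nu> \<Longrightarrow> (\<integral>\<^sup>+x\<in>A. F q x \<partial>\<nu>) = emeasure \<gamma> (A \<times> {..ereal (of_rat q)})"
proof -
  interpret \<gamma>: prob_space \<gamma> by fact
  have fst_meas: "fst \<in> \<gamma> \<rightarrow>\<^sub>M \<nu>" using measurable_fst measurable_cong_sets[OF sets_\<gamma> refl] by blast
  interpret \<nu>: prob_space \<nu>
    using \<gamma>.prob_space_distr[OF fst_meas] by (simp add: \<nu>)
  have space_\<gamma>: "space \<gamma> = space \<nu> \<times> UNIV"
    using sets_eq_imp_space_eq[OF sets_\<gamma>] by (simp add: space_pair_measure)
  have rect: "A \<times> B \<in> sets \<gamma>" if "A \<in> sets \<nu>" "B \<in> sets borel" for A B
    using that by (simp add: sets_\<gamma>)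
  have em_fst: "emeasure \<nu> A = emeasure \<gamma> (A \<times> UNIV)" if A: "A \<in> sets \<nu>" for A
  proof -
    have "fst -` A \<inter> space \<gamma> = A \<times> UNIV" using sets.sets_into_space[OF A] by (auto simp: space_\<gamma>)
    then show ?thesis using emeasure_distr[OF fst_meas A] by (simp add: \<nu>)
  qed
  have "\<exists>f\<in>borel_measurable \<nu>. \<forall>A\<in>sets \<nu>.
      (\<integral>\<^sup>+x\<in>A. f x \<partial>\<nu>) = emeasure \<gamma> (A \<times> {..ereal (of_rat q)})" for q
  proof -
    let ?S = "space \<nu> \<times> {..ereal (of_rat q)}"
    \<comment> \<open>\<open>K\<close> is the first marginal of \<open>\<gamma>\<close> restricted
      to second components at most \<open>q\<close>. It is dominated by \<open>\<nu>\<close>, and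
      its density is the conditional distribution function at \<open>q\<close>.\<close>
    define K where "K = distr (density \<gamma> (indicator ?S)) \<nu> fst"
    have fst_meas': "fst \<in> density \<gamma> (indicator ?S) \<rightarrow>\<^sub>M \<nu>" using fst_meas by simp
    have K: "emeasure K A = emeasure \<gamma> (A \<times> {..ereal (of_rat q)})" if A: "A \<in> sets \<nu>" for A
    proof -
      have "emeasure K A = emeasure (density \<gamma> (indicator ?S)) (fst -` A \<inter> space \<gamma>)"
        using emeasure_distr[OF fst_meas' A] by (simp add: K_def)
      also have "fst -` A \<inter> space \<gamma> = A \<times> UNIV"
        using sets.sets_into_space[OF A] by (auto simp: space_\<gamma>)
      also have "emeasure (density \<gamma> (indicator ?S)) (A \<times> UNIV) =
          (\<integral>\<^sup>+z. indicator (A \<times> {..ereal (of_rat q)}) z \<partial>\<gamma>)"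
        using sets.sets_into_space[OF A]
        by (subst emeasure_density)
           (auto intro!: rect A nn_integral_cong borel_measurable_indicator split: split_indicator)
      finally show ?thesis using rect[OF A] by simp
    qed
    have "absolutely_continuous \<nu> K"
      unfolding absolutely_continuous_def
    proof
      fix A assume "A \<in> null_sets \<nu>"
      then have A: "A \<in> sets \<nu>" "emeasure \<gamma> (A \<times> UNIV) = 0"
        using em_fst by (auto simp: null_sets_def)
      then have "emeasure \<gamma> (A \<times> {..ereal (of_rat q)}) = 0"
        using emeasure_mono[of "A \<times> {..ereal (of_rat q)}" "A \<times> UNIV" \<gamma>] rect[OF A(1)] by auto
      then show "A \<in> null_sets K" using A(1) K by (auto simp: null_sets_def K_def)
    qed
    then obtain f where f: "f \<in> borel_measurable \<nu>" "density \<nu> f = K"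
      using \<nu>.Radon_Nikodym[of K] by (auto simp: K_def)
    have "(\<integral>\<^sup>+x\<in>A. f x \<partial>\<nu>) = emeasure \<gamma> (A \<times> {..ereal (of_rat q)})" if "A \<in> sets \<nu>" for A
      using emeasure_density[OF f(1) that] K[OF that] f(2) by simp
    with f(1) show ?thesis by blast
  qed
  then obtain f where f[measurable]: "\<And>q. f q \<in> borel_measurable \<nu>"
    and f_int: "\<And>q A. A \<in> sets \<nu> \<Longrightarrow> (\<integral>\<^sup>+x\<in>A. f q x \<partial>\<nu>) = emeasure \<gamma> (A \<times> {..ereal (of_rat q)})"
    by metis
  have f_total: "(\<integral>\<^sup>+x. f q x \<partial>\<nu>) \<le> 1" for q
  proof -
    have "(\<integral>\<^sup>+x. f q x \<partial>\<nu>) = (\<integral>\<^sup>+x\<in>space \<nu>. f q x \<partial>\<nu>)"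
      by (rule nn_integral_cong) simp
    then show ?thesis using f_int[OF sets.top] \<gamma>.emeasure_le_1 by simp
  qed
  have "AE x in \<nu>. f p x \<le> f q x" if "p \<le> q" for p q
  proof (rule AE_le_of_set_nn_integral_le)
    fix A assume A: "A \<in> sets \<nu>"
    show "(\<integral>\<^sup>+x\<in>A. f p x \<partial>\<nu>) \<le> (\<integral>\<^sup>+x\<in>A. f q x \<partial>\<nu>)"
      unfolding f_int[OF A] using that
      by (intro emeasure_mono rect A) (auto simp: of_rat_less_eq elim: order_trans)
  qed (use f_total[of q] in \<open>auto simp: top_unique\<close>)
  moreover have "AE x in \<nu>. f q x \<le> 1" for q
  proof (rule AE_le_of_set_nn_integral_le)
    fix A assume A: "A \<in> sets \<nu>"
    show "(\<integral>\<^sup>+x\<in>A. f q x \<partial>\<nu>) \<le> (\<integral>\<^sup>+x\<in>A. 1 \<partial>\<nu>)"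
      unfolding f_int[OF A] using A
      by (auto simp: em_fst intro!: emeasure_mono rect)
  qed (auto simp: \<nu>.emeasure_space_1)
  \<comment> \<open>Indexing by rationals leaves countably many exceptional sets, which merge into
    one null set.\<close>
  ultimately have "AE x in \<nu>. \<forall>p q. (p \<le> q \<longrightarrow> f p x \<le> f q x) \<and> f q x \<le> 1"
    unfolding AE_all_countable by auto
  then have AE_Z: "AE x in \<nu>. x \<in> {x \<in> space \<nu>. \<forall>p q. (p \<le> q \<longrightarrow> f p x \<le> f q x) \<and> f q x \<le> 1}"
    by (simp add: AE_conj_iff)
  define Z where "Z = {x \<in> space \<nu>. \<forall>p q. (p \<le> q \<longrightarrow> f p x \<le> f q x) \<and> f q x \<le> 1}"
  have [measurable]: "Z \<in> sets \<nu>" unfolding Z_def by measurable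
  define F where "F q x = f q x * indicator Z x" for q x
  show ?thesis
  proof (rule that)
    show "F q \<in> borel_measurable \<nu>" for q unfolding F_def by measurable
    show "F p x \<le> F q x" if "p \<le> q" for p q x using that by (auto simp: F_def Z_def indicator_def)
    show "F q x \<le> 1" for q x by (auto simp: F_def Z_def indicator_def)
    fix q A assume A: "A \<in> sets \<nu>"
    have "(\<integral>\<^sup>+x\<in>A. F q x \<partial>\<nu>) = (\<integral>\<^sup>+x\<in>A. f q x \<partial>\<nu>)"
      using AE_Z by (intro nn_integral_cong_AE) (auto simp: F_def Z_def[symmetric])
    then show "(\<integral>\<^sup>+x\<in>A. F q x \<partial>\<nu>) = emeasure \<gamma> (A \<times> {..ereal (of_rat q)})"
      using f_int[OF A] by simp
  qed
qed

section \<open>The conditional quantile transform\<close>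

definition unit_interval_measure :: "real measure" where
  "unit_interval_measure = uniform_measure lborel {0..1}"

lemma sets_unit_interval_measure [simp, measurable_cong]: "sets unit_interval_measure = sets borel"
  and space_unit_interval_measure [simp]: "space unit_interval_measure = UNIV"
  by (simp_all add: unit_interval_measure_def)

lemma prob_space_unit_interval_measure: "prob_space unit_interval_measure"
  unfolding unit_interval_measure_def by (rule prob_space_uniform_measure) auto

text \<open>Negative \<open>t\<close> satisfy the condition because \<open>ennreal\<close> truncates
  at 0, but they carry no mass.\<close>

lemma emeasure_unit_interval_measure:
  assumes "c \<le> 1" shows "emeasure unit_interval_measure {t. ennreal t \<le> c} = c"
proof -
  obtain r where r: "c = ennreal r" "0 \<le> r" using assms by (cases c) (auto simp: top_unique)
  then have "r \<le> 1" using assms by simp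
  then have "{0..1} \<inter> {t. ennreal t \<le> c} = {0..r}" using r by auto
  then show ?thesis
    using r by (simp add: unit_interval_measure_def divide_ennreal flip: ennreal_1)
qed

text \<open>\<open>h (x, t)\<close> is the infimum of the rationals \<open>q\<close> with
  \<open>t \<le> F q x\<close>, the conditional quantile. The event \<open>h < y\<close> is a union
  over rationals \<open>q < y\<close>, so comparing open half-lines by continuity from below avoids
  right continuity of \<open>F\<close>. Extended real values absorb empty or unbounded sets of such
  \<open>q\<close>.\<close>

lemma quantile_transfer:
  fixes \<gamma> :: "('a \<times> ereal) measure"
  assumes "prob_space \<gamma>" and sets_\<gamma>: "sets \<gamma> = sets (\<nu> \<Otimes>\<^sub>M borel)" and \<nu>: "distr \<gamma> \<nu> fst = \<nu>"
  obtains h where "h \<in> borel_measurable (\<nu> \<Otimes>\<^sub>M borel)"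
    "distr (\<nu> \<Otimes>\<^sub>M unit_interval_measure) (\<nu> \<Otimes>\<^sub>M borel) (\<lambda>z. (fst z, h z)) = \<gamma>"
proof -
  let ?P = "unit_interval_measure"
  interpret \<gamma>: prob_space \<gamma> by fact
  interpret P: prob_space ?P by (rule prob_space_unit_interval_measure)
  have fst_meas: "fst \<in> \<gamma> \<rightarrow>\<^sub>M \<nu>" using measurable_fst measurable_cong_sets[OF sets_\<gamma> refl] by blast
  interpret \<nu>: prob_space \<nu>
    using \<gamma>.prob_space_distr[OF fst_meas] by (simp add: \<nu>)
  interpret \<nu>P: prob_space "\<nu> \<Otimes>\<^sub>M ?P" by (rule prob_space_pair) unfold_locales
  have rect: "A \<times> B \<in> sets \<gamma>" if "A \<in> sets \<nu>" "B \<in> sets borel" for A B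
    using that by (simp add: sets_\<gamma>)
  have space_\<gamma>: "space \<gamma> = space \<nu> \<times> UNIV"
    using sets_eq_imp_space_eq[OF sets_\<gamma>] by (simp add: space_pair_measure)
  obtain F :: "rat \<Rightarrow> 'a \<Rightarrow> ennreal" where F[measurable]: "\<And>q. F q \<in> borel_measurable \<nu>"
    and F_mono: "\<And>p q x. p \<le> q \<Longrightarrow> F p x \<le> F q x" and F_le_1: "\<And>q x. F q x \<le> 1"
    and F_int: "\<And>q A. A \<in> sets \<nu> \<Longrightarrow> (\<integral>\<^sup>+x\<in>A. F q x \<partial>\<nu>) = emeasure \<gamma> (A \<times> {..ereal (of_rat q)})"
    using conditional_cdf[OF assms] by blast
  define h where "h z = (INF q. if ennreal (snd z) \<le> F q (fst z) then ereal (of_rat q) else \<infinity>)" for z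
  have h[measurable]: "h \<in> borel_measurable (\<nu> \<Otimes>\<^sub>M borel)" unfolding h_def by measurable
  have h_less: "h z < y \<longleftrightarrow> (\<exists>q. ereal (of_rat q) < y \<and> ennreal (snd z) \<le> F q (fst z))" for z y
    unfolding h_def INF_less_iff by (auto split: if_splits)
  let ?Q = "distr (\<nu> \<Otimes>\<^sub>M ?P) (\<nu> \<Otimes>\<^sub>M borel) (\<lambda>z. (fst z, h z))"
  have map_meas: "(\<lambda>z. (fst z, h z)) \<in> \<nu> \<Otimes>\<^sub>M ?P \<rightarrow>\<^sub>M \<nu> \<Otimes>\<^sub>M borel"
    by measurable
  have below: "emeasure ?Q (A \<times> {..<y}) = emeasure \<gamma> (A \<times> {..<y})" if A[measurable]: "A \<in> sets \<nu>" for A y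
  proof (cases "\<exists>q. ereal (of_rat q) < y")
    case False
    then have "{..<y} = {}"
      using ereal_dense2[of _ y] ereal_dense3[of _ y] by auto
    then show ?thesis by simp
  next
    case True
    define I where "I = {q. ereal (of_rat q) < y}"
    have I: "I \<noteq> {}" "countable I" using True by (auto simp: I_def)
    \<comment> \<open>Running maxima of an enumeration give an increasing sequence cofinal in the
      rationals below \<open>y\<close>, as continuity from below requires.\<close>
    define s where "s n = Max (from_nat_into I ` {..n})" for n
    have s_ge: "from_nat_into I n \<le> s n" for n by (simp add: s_def)
    have "s n \<in> from_nat_into I ` {..n}" for n unfolding s_def by (rule Max_in) auto
    then have s_I: "s n \<in> I" for n using from_nat_into[OF I(1)] by (metis imageE)
    have s_cofinal: "\<exists>n. q \<le> s n" if "q \<in> I" for q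
      using from_nat_into_surj[OF I(2) that] s_ge by metis
    have s_mono: "mono s" unfolding s_def by (intro monoI Max_mono) auto
    define C where "C n = {z \<in> space (\<nu> \<Otimes>\<^sub>M ?P). fst z \<in> A \<and> ennreal (snd z) \<le> F (s n) (fst z)}" for n
    have C: "C n \<in> sets (\<nu> \<Otimes>\<^sub>M ?P)" for n unfolding C_def by measurable
    have em_C: "emeasure (\<nu> \<Otimes>\<^sub>M ?P) (C n) = emeasure \<gamma> (A \<times> {..ereal (of_rat (s n))})" for n
    proof -
      have "emeasure (\<nu> \<Otimes>\<^sub>M ?P) (C n) = (\<integral>\<^sup>+x. emeasure ?P (Pair x -` C n) \<partial>\<nu>)"
        by (rule P.emeasure_pair_measure_alt[OF C])
      also have "\<dots> = (\<integral>\<^sup>+x\<in>A. F (s n) x \<partial>\<nu>)"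
      proof (rule nn_integral_cong)
        fix x assume x: "x \<in> space \<nu>"
        have "Pair x -` C n = (if x \<in> A then {t. ennreal t \<le> F (s n) x} else {})"
          using x by (auto simp: C_def space_pair_measure)
        then show "emeasure ?P (Pair x -` C n) = F (s n) x * indicator A x"
          by (simp add: emeasure_unit_interval_measure[OF F_le_1])
      qed
      finally show ?thesis using F_int[OF A] by simp
    qed
    have "(\<lambda>z. (fst z, h z)) -` (A \<times> {..<y}) \<inter> space (\<nu> \<Otimes>\<^sub>M ?P) = (\<Union>n. C n)"
    proof (intro set_eqI iffI)
      fix z assume "z \<in> (\<lambda>z. (fst z, h z)) -` (A \<times> {..<y}) \<inter> space (\<nu> \<Otimes>\<^sub>M ?P)"
      then obtain q where q: "z \<in> space (\<nu> \<Otimes>\<^sub>M ?P)" "fst z \<in> A" "q \<in> I" "ennreal (snd z) \<le> F q (fst z)"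
        using h_less by (auto simp: I_def)
      then obtain n where "q \<le> s n" using s_cofinal by blast
      then have "ennreal (snd z) \<le> F (s n) (fst z)" using q(4) F_mono order_trans by blast
      then show "z \<in> (\<Union>n. C n)" using q by (auto simp: C_def)
    next
      fix z assume "z \<in> (\<Union>n. C n)"
      then show "z \<in> (\<lambda>z. (fst z, h z)) -` (A \<times> {..<y}) \<inter> space (\<nu> \<Otimes>\<^sub>M ?P)"
        using s_I h_less[of z y] by (auto simp: C_def I_def)
    qed
    then have "emeasure ?Q (A \<times> {..<y}) = emeasure (\<nu> \<Otimes>\<^sub>M ?P) (\<Union>n. C n)"
      by (subst emeasure_distr[OF map_meas]) auto
    also have "\<dots> = (SUP n. emeasure (\<nu> \<Otimes>\<^sub>M ?P) (C n))"
    proof (rule SUP_emeasure_incseq[symmetric])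
      show "incseq C"
        using F_mono[OF monoD[OF s_mono]] by (auto simp: C_def incseq_def intro: order_trans)
    qed (use C in auto)
    also have "\<dots> = (SUP n. emeasure \<gamma> (A \<times> {..ereal (of_rat (s n))}))" by (simp add: em_C)
    also have "\<dots> = emeasure \<gamma> (\<Union>n. A \<times> {..ereal (of_rat (s n))})"
    proof (rule SUP_emeasure_incseq)
      show "incseq (\<lambda>n. A \<times> {..ereal (of_rat (s n))})"
        using monoD[OF s_mono] by (auto simp: incseq_def of_rat_less_eq elim: order_trans)
    qed (use rect[OF A] in auto)
    also have "(\<Union>n. A \<times> {..ereal (of_rat (s n))}) = A \<times> {..<y}"
    proof (intro set_eqI iffI)
      fix z assume "z \<in> A \<times> {..<y}"
      then have z: "fst z \<in> A" "snd z < y" by auto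
      obtain r where r: "snd z < ereal (of_rat r)" "ereal (of_rat r) < y"
        using ereal_dense3[OF z(2)] by blast
      then obtain n where "r \<le> s n" using s_cofinal by (auto simp: I_def)
      then have "ereal (of_rat r) \<le> ereal (of_rat (s n))" by (simp add: of_rat_less_eq)
      then have "snd z \<le> ereal (of_rat (s n))" using r(1) by order
      then show "z \<in> (\<Union>n. A \<times> {..ereal (of_rat (s n))})" using z(1) by (cases z) auto
    next
      fix z assume "z \<in> (\<Union>n. A \<times> {..ereal (of_rat (s n))})"
      then show "z \<in> A \<times> {..<y}" using s_I unfolding I_def by (cases z) (auto elim: le_less_trans)
    qed
    finally show ?thesis .
  qed
  let ?\<Omega> = "space \<nu> \<times> (UNIV :: ereal set)"
  \<comment> \<open>\<open>UNIV\<close> is added because even \<open>{..<\<infinity>}\<close> omits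
    the point \<infinity>; it also puts the whole space into the generator.\<close>
  let ?E = "{A \<times> B | A B. A \<in> sets \<nu> \<and> B \<in> insert UNIV (range (lessThan :: ereal \<Rightarrow> _))}"
  have E_Pow: "?E \<subseteq> Pow ?\<Omega>" using sets.sets_into_space by fastforce
  have sets_E: "sets (\<nu> \<Otimes>\<^sub>M (borel :: ereal measure)) = sigma_sets ?\<Omega> ?E"
  proof
    have "(\<lambda>z. z) \<in> sigma ?\<Omega> ?E \<rightarrow>\<^sub>M \<nu> \<Otimes>\<^sub>M borel"
    proof (rule measurable_pair)
      show "fst \<circ> (\<lambda>z. z) \<in> sigma ?\<Omega> ?E \<rightarrow>\<^sub>M \<nu>"
      proof (rule measurableI)
        fix A assume A: "A \<in> sets \<nu>"
        have "(fst \<circ> (\<lambda>z. z)) -` A \<inter> ?\<Omega> = A \<times> UNIV"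
          using sets.sets_into_space[OF A] by auto
        moreover have "A \<times> UNIV \<in> ?E" using A by blast
        ultimately show "(fst \<circ> (\<lambda>z. z)) -` A \<inter> space (sigma ?\<Omega> ?E) \<in> sets (sigma ?\<Omega> ?E)"
          by (simp only: space_measure_of[OF E_Pow] sets_measure_of[OF E_Pow]) (rule sigma_sets.Basic)
      qed (use E_Pow in \<open>auto simp: space_measure_of\<close>)
      show "snd \<circ> (\<lambda>z. z) \<in> sigma ?\<Omega> ?E \<rightarrow>\<^sub>M borel"
        unfolding borel_Iio
      proof (rule measurable_measure_of)
        fix B :: "ereal set" assume "B \<in> range lessThan"
        moreover have "(snd \<circ> (\<lambda>z. z)) -` B \<inter> ?\<Omega> = space \<nu> \<times> B" by auto
        ultimately have "(snd \<circ> (\<lambda>z. z)) -` B \<inter> ?\<Omega> \<in> ?E" by blast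
        then show "(snd \<circ> (\<lambda>z. z)) -` B \<inter> space (sigma ?\<Omega> ?E) \<in> sets (sigma ?\<Omega> ?E)"
          by (simp only: space_measure_of[OF E_Pow] sets_measure_of[OF E_Pow]) (rule sigma_sets.Basic)
      qed auto
    qed
    from measurable_sets[OF this] show "sets (\<nu> \<Otimes>\<^sub>M (borel :: ereal measure)) \<subseteq> sigma_sets ?\<Omega> ?E"
      using E_Pow sets.sets_into_space[of _ "\<nu> \<Otimes>\<^sub>M (borel :: ereal measure)"]
      by (auto simp: space_measure_of sets_measure_of space_pair_measure Int_absorb2)
    have "?E \<subseteq> sets (\<nu> \<Otimes>\<^sub>M borel)" by (auto intro!: pair_measureI)
    moreover have "?\<Omega> \<in> sets (\<nu> \<Otimes>\<^sub>M borel)" by simp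
    ultimately show "sigma_sets ?\<Omega> ?E \<subseteq> sets (\<nu> \<Otimes>\<^sub>M (borel :: ereal measure))"
      by (intro sets.sigma_sets_subset')
  qed
  have "?Q = \<gamma>"
  proof (rule measure_eqI_generator_eq[of ?E ?\<Omega>])
    show "Int_stable ?E"
    proof (rule Int_stableI)
      fix X Y assume "X \<in> ?E" "Y \<in> ?E"
      then obtain A A' and B B' :: "ereal set" where XY: "X = A \<times> B" "Y = A' \<times> B'" "A \<in> sets \<nu>" "A' \<in> sets \<nu>"
        "B \<in> insert UNIV (range lessThan)" "B' \<in> insert UNIV (range lessThan)" by blast
      have "{..<a} \<inter> {..<b} = {..<min a b}" for a b :: ereal by auto
      then have "B \<inter> B' \<in> insert UNIV (range lessThan)" using XY(5,6) by auto
      moreover have "X \<inter> Y = (A \<inter> A') \<times> (B \<inter> B')" using XY by auto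
      ultimately show "X \<inter> Y \<in> ?E" using XY(3,4) by blast
    qed
    fix X assume "X \<in> ?E"
    then obtain A and B :: "ereal set" where X: "X = A \<times> B" "A \<in> sets \<nu>" "B \<in> insert UNIV (range lessThan)" by blast
    show "emeasure ?Q X = emeasure \<gamma> X"
    proof (cases "B = UNIV")
      case True
      have "emeasure ?Q X = emeasure (\<nu> \<Otimes>\<^sub>M ?P) (A \<times> UNIV)"
        using X(1,2) True sets.sets_into_space[OF X(2)]
        by (subst emeasure_distr[OF map_meas]) (auto simp: space_pair_measure intro!: arg_cong2[where f = emeasure])
      also have "\<dots> = emeasure \<nu> A"
        using P.emeasure_pair_measure_Times[OF X(2), of UNIV] P.emeasure_space_1 by simp
      also have "\<dots> = emeasure (distr \<gamma> \<nu> fst) A" by (simp add: \<nu>)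
      also have "\<dots> = emeasure \<gamma> X"
        using sets.sets_into_space[OF X(2)] X True
        by (subst emeasure_distr[OF fst_meas X(2)]) (auto simp: space_\<gamma> intro!: arg_cong2[where f = emeasure])
      finally show ?thesis .
    next
      case False
      then show ?thesis using X below by auto
    qed
  next
    show "range (\<lambda>_::nat. ?\<Omega>) \<subseteq> ?E" by blast
    show "emeasure ?Q ?\<Omega> \<noteq> \<infinity>"
      using finite_measure.emeasure_finite[OF prob_space.finite_measure[OF \<nu>P.prob_space_distr[OF map_meas]]]
      by simp
  qed (use E_Pow sets_E sets_\<gamma> in auto)
  with h show ?thesis by (rule that)
qed

text \<open>A Borel section of \<open>\<phi>\<close> on all of \<open>R\<close> need not exist.
  Selection applied to the pairs with \<open>\<phi> \<sigma> = r\<close>, a measurable set since the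
  diagonal of a Hausdorff space is closed, gives one off a null set, enough for statements about
  laws.\<close>

lemma AE_measurable_right_inverse:
  assumes R: "Polish_topology R" and "finite_measure \<rho>" and \<rho>: "sets \<rho> = sets (borel_of R)"
    and \<phi>: "\<phi> \<in> baire \<rightarrow>\<^sub>M borel_of R" "range \<phi> = topspace R"
  obtains w where "w \<in> borel_of R \<rightarrow>\<^sub>M baire" "AE r in \<rho>. \<phi> (w r) = r"
proof -
  have R2: "second_countable R" using R by (rule Polish_topology_second_countable)
  let ?D = "{z \<in> topspace (prod_topology R R). fst z = snd z}"
  have "closedin (prod_topology R R) ?D"
    using Polish_topology_Hausdorff[OF R] unfolding Hausdorff_space_closedin_diagonal
    by (rule back_subst[where P = "closedin _"]) auto
  then have D: "?D \<in> sets (borel_of R \<Otimes>\<^sub>M borel_of R)"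
    using borel_of_closedin sets_borel_of_prod[OF R2 R2] by blast
  have space_\<rho>: "space \<rho> = topspace R" using sets_eq_imp_space_eq[OF \<rho>] by simp
  let ?B = "{z \<in> space (\<rho> \<Otimes>\<^sub>M baire). \<phi> (snd z) = fst z}"
  have [measurable_cong]: "sets \<rho> = sets (borel_of R)" by (fact \<rho>)
  have "(\<lambda>z. (fst z, \<phi> (snd z))) \<in> \<rho> \<Otimes>\<^sub>M baire \<rightarrow>\<^sub>M borel_of R \<Otimes>\<^sub>M borel_of R"
    using \<phi>(1)[measurable] by measurable
  from measurable_sets[OF this D]
  have "(\<lambda>z. (fst z, \<phi> (snd z))) -` ?D \<inter> space (\<rho> \<Otimes>\<^sub>M baire) \<in> sets (\<rho> \<Otimes>\<^sub>M baire)" .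
  also have "(\<lambda>z. (fst z, \<phi> (snd z))) -` ?D \<inter> space (\<rho> \<Otimes>\<^sub>M baire) = ?B"
    using \<phi>(2) by (auto simp: space_pair_measure space_\<rho>)
  finally have B: "?B \<in> sets (\<rho> \<Otimes>\<^sub>M baire)" .
  obtain D H w where DH: "D \<in> sets \<rho>" "H \<in> sets \<rho>" "H - D \<in> null_sets \<rho>"
    "{x. \<exists>\<sigma>. (x, \<sigma>) \<in> ?B} \<subseteq> H" "w \<in> \<rho> \<rightarrow>\<^sub>M baire" "\<And>x. x \<in> D \<Longrightarrow> (x, w x) \<in> ?B"
    by (rule measurable_selection_baire[OF assms(2) B]) blast
  show ?thesis
  proof (rule that)
    show "w \<in> borel_of R \<rightarrow>\<^sub>M baire" using DH(5) measurable_cong_sets[OF \<rho> refl] by blast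
    show "AE r in \<rho>. \<phi> (w r) = r"
      using AE_not_in[OF DH(3)] AE_space
    proof eventually_elim
      case (elim r)
      then obtain \<sigma> where "\<phi> \<sigma> = r" using \<phi>(2) space_\<rho> by (metis imageE)
      then have "r \<in> H" using DH(4) elim(2) by (auto simp: space_pair_measure)
      then show ?case using elim(1) DH(6)[of r] by auto
    qed
  qed
qed

text \<open>
  Regular conditional probabilities are replaced by a randomisation: after coding \<open>R\<close> by numbers,
  \<open>\<gamma>\<close> is the law of a function of its first component and an independent uniform variable, and that
  function can be evaluated at \<open>f l\<close> for a point \<open>l\<close> drawn from \<open>\<Lambda>\<close>.
\<close>

lemma gluing:
  assumes "prob_space \<Lambda>" "prob_space \<gamma>" and sets_\<gamma>: "sets \<gamma> = sets (M \<Otimes>\<^sub>M borel_of R)"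
    and f[measurable]: "f \<in> \<Lambda> \<rightarrow>\<^sub>M M" and marg: "distr \<gamma> M fst = distr \<Lambda> M f"
    and R: "Polish_topology R"
  obtains \<pi> where "prob_space \<pi>" "sets \<pi> = sets (\<Lambda> \<Otimes>\<^sub>M borel_of R)" "distr \<pi> \<Lambda> fst = \<Lambda>"
    "distr \<pi> (M \<Otimes>\<^sub>M borel_of R) (\<lambda>z. (f (fst z), snd z)) = \<gamma>"
proof -
  let ?BR = "borel_of R" and ?P = "unit_interval_measure"
  interpret \<Lambda>: prob_space \<Lambda> by fact
  interpret \<gamma>: prob_space \<gamma> by fact
  interpret P: prob_space ?P by (rule prob_space_unit_interval_measure)
  interpret \<Lambda>P: prob_space "\<Lambda> \<Otimes>\<^sub>M ?P" by (rule prob_space_pair) unfold_locales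
  note sets_\<gamma>[measurable_cong]
  define \<nu> where "\<nu> = distr \<Lambda> M f"
  have sets_\<nu>[simp, measurable_cong]: "sets \<nu> = sets M" by (simp add: \<nu>_def)
  define \<rho> where "\<rho> = distr \<gamma> ?BR snd"
  have snd_meas[measurable]: "snd \<in> \<gamma> \<rightarrow>\<^sub>M ?BR" by measurable
  interpret \<rho>: prob_space \<rho> unfolding \<rho>_def by (rule \<gamma>.prob_space_distr) measurable
  have "topspace R \<noteq> {}" using \<rho>.not_empty by (simp add: \<rho>_def)
  then obtain \<phi> where \<phi>[measurable]: "\<phi> \<in> baire \<rightarrow>\<^sub>M ?BR" and range_\<phi>: "range \<phi> = topspace R"
    using Polish_topology_baire_surjection[OF R] by blast
  obtain w where w[measurable]: "w \<in> ?BR \<rightarrow>\<^sub>M baire" and "AE r in \<rho>. \<phi> (w r) = r"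
    by (rule AE_measurable_right_inverse[OF R \<rho>.finite_measure_axioms _ \<phi> range_\<phi>]) (auto simp: \<rho>_def)
  then have w_AE: "AE z in \<gamma>. \<phi> (w (snd z)) = snd z"
    unfolding \<rho>_def using AE_distrD[OF snd_meas] by blast
  obtain \<zeta> :: "(nat \<Rightarrow> nat) \<Rightarrow> real" and \<beta> where \<zeta>[measurable]: "\<zeta> \<in> borel_measurable baire"
    and \<beta>[measurable]: "\<beta> \<in> borel \<rightarrow>\<^sub>M baire" and \<beta>\<zeta>: "\<And>\<sigma>. \<beta> (\<zeta> \<sigma>) = \<sigma>"
    using baire_real_coding by blast
  define dec where "dec y = \<phi> (\<beta> (real_of_ereal y))" for y
  have dec[measurable]: "dec \<in> borel \<rightarrow>\<^sub>M ?BR" unfolding dec_def by measurable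
  \<comment> \<open>The second component is coded as a number, because the quantile transform needs
    an ordered target.\<close>
  define \<gamma>' where "\<gamma>' = distr \<gamma> (\<nu> \<Otimes>\<^sub>M borel) (\<lambda>z. (fst z, ereal (\<zeta> (w (snd z)))))"
  have enc_meas: "(\<lambda>z. (fst z, ereal (\<zeta> (w (snd z))))) \<in> \<gamma> \<rightarrow>\<^sub>M \<nu> \<Otimes>\<^sub>M borel" by measurable
  have "prob_space \<gamma>'" unfolding \<gamma>'_def by (rule \<gamma>.prob_space_distr[OF enc_meas])
  moreover have "sets \<gamma>' = sets (\<nu> \<Otimes>\<^sub>M borel)" by (simp add: \<gamma>'_def)
  moreover have "distr \<gamma>' \<nu> fst = \<nu>"
  proof -
    have "distr \<gamma>' \<nu> fst = distr \<gamma> \<nu> fst"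
      unfolding \<gamma>'_def by (subst distr_distr[OF _ enc_meas]) (auto simp: comp_def)
    also have "\<dots> = distr \<gamma> M fst" by (rule distr_cong) auto
    finally show ?thesis by (simp add: marg \<nu>_def)
  qed
  ultimately obtain h where h[measurable]: "h \<in> borel_measurable (\<nu> \<Otimes>\<^sub>M borel)"
    and h_distr: "distr (\<nu> \<Otimes>\<^sub>M ?P) (\<nu> \<Otimes>\<^sub>M borel) (\<lambda>z. (fst z, h z)) = \<gamma>'"
    by (rule quantile_transfer)
  define k where "k z = (fst z, dec (h (f (fst z), snd z)))" for z
  have k[measurable]: "k \<in> \<Lambda> \<Otimes>\<^sub>M ?P \<rightarrow>\<^sub>M \<Lambda> \<Otimes>\<^sub>M ?BR" unfolding k_def by measurable
  define \<pi> where "\<pi> = distr (\<Lambda> \<Otimes>\<^sub>M ?P) (\<Lambda> \<Otimes>\<^sub>M ?BR) k"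
  have "distr \<pi> \<Lambda> fst = distr (\<Lambda> \<Otimes>\<^sub>M ?P) \<Lambda> fst"
    unfolding \<pi>_def by (subst distr_distr) (auto simp: comp_def k_def)
  also have "\<dots> = \<Lambda>" by (rule P.distr_pair_fst)
  finally have \<pi>_fst: "distr \<pi> \<Lambda> fst = \<Lambda>" .
  \<comment> \<open>Applying \<open>f\<close> to the first component turns \<open>\<Lambda>\<close>
    times the uniform law into \<open>\<nu>\<close> times the uniform law, the measure for which the
    law of \<open>h\<close> is known.\<close>
  have push: "(\<lambda>z. (f (fst z), snd z)) \<in> \<Lambda> \<Otimes>\<^sub>M ?P \<rightarrow>\<^sub>M \<nu> \<Otimes>\<^sub>M ?P" by measurable
  have "distr (\<Lambda> \<Otimes>\<^sub>M ?P) (\<nu> \<Otimes>\<^sub>M ?P) (\<lambda>z. (f (fst z), snd z)) = distr \<Lambda> \<nu> f \<Otimes>\<^sub>M distr ?P ?P (\<lambda>t. t)"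
    by (subst pair_measure_distr) (auto simp: split_beta' P.sigma_finite_measure_axioms)
  also have "distr \<Lambda> \<nu> f = \<nu>" unfolding \<nu>_def by (rule distr_cong) auto
  finally have push_distr: "distr (\<Lambda> \<Otimes>\<^sub>M ?P) (\<nu> \<Otimes>\<^sub>M ?P) (\<lambda>z. (f (fst z), snd z)) = \<nu> \<Otimes>\<^sub>M ?P" by simp
  have q_meas: "(\<lambda>z. (fst z, h z)) \<in> \<nu> \<Otimes>\<^sub>M ?P \<rightarrow>\<^sub>M \<nu> \<Otimes>\<^sub>M borel" by measurable
  have dec_meas: "(\<lambda>z. (fst z, dec (snd z))) \<in> \<nu> \<Otimes>\<^sub>M borel \<rightarrow>\<^sub>M M \<Otimes>\<^sub>M ?BR" by measurable
  have "distr \<pi> (M \<Otimes>\<^sub>M ?BR) (\<lambda>z. (f (fst z), snd z))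
      = distr (\<Lambda> \<Otimes>\<^sub>M ?P) (M \<Otimes>\<^sub>M ?BR) (\<lambda>z. (f (fst z), dec (h (f (fst z), snd z))))"
    unfolding \<pi>_def by (subst distr_distr) (auto simp: comp_def k_def)
  also have "\<dots> = distr (distr (\<Lambda> \<Otimes>\<^sub>M ?P) (\<nu> \<Otimes>\<^sub>M ?P) (\<lambda>z. (f (fst z), snd z))) (M \<Otimes>\<^sub>M ?BR)
      (\<lambda>z. (fst z, dec (h z)))"
    by (subst distr_distr[OF _ push]) (auto simp: comp_def)
  also have "\<dots> = distr (distr (\<nu> \<Otimes>\<^sub>M ?P) (\<nu> \<Otimes>\<^sub>M borel) (\<lambda>z. (fst z, h z))) (M \<Otimes>\<^sub>M ?BR)
      (\<lambda>z. (fst z, dec (snd z)))"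
    unfolding push_distr by (subst distr_distr[OF dec_meas q_meas]) (simp add: comp_def)
  also have "\<dots> = distr \<gamma> (M \<Otimes>\<^sub>M ?BR) (\<lambda>z. (fst z, \<phi> (w (snd z))))"
    unfolding h_distr \<gamma>'_def
    by (subst distr_distr[OF dec_meas enc_meas]) (simp add: comp_def dec_def \<beta>\<zeta>)
  \<comment> \<open>Decoding undoes coding only almost everywhere, which leaves the law
    unchanged.\<close>
  also have "\<dots> = distr \<gamma> (M \<Otimes>\<^sub>M ?BR) (\<lambda>z. z)"
    by (rule distr_cong_AE) (use w_AE in auto)
  also have "\<dots> = \<gamma>" by (rule distr_id2) (simp add: sets_\<gamma>)
  finally have "distr \<pi> (M \<Otimes>\<^sub>M ?BR) (\<lambda>z. (f (fst z), snd z)) = \<gamma>" .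
  moreover have "prob_space \<pi>" unfolding \<pi>_def by (rule \<Lambda>P.prob_space_distr[OF k])
  moreover have "sets \<pi> = sets (\<Lambda> \<Otimes>\<^sub>M ?BR)" by (simp add: \<pi>_def)
  ultimately show ?thesis using \<pi>_fst that by blast
qed

subsection \<open>Transport costs and one step of the recursion\<close>

lemma sets_borel_of_prod_Polish:
  "Polish_topology S \<Longrightarrow> Polish_topology T \<Longrightarrow>
    sets (borel_of (prod_topology S T)) = sets (borel_of S \<Otimes>\<^sub>M borel_of T)"
  by (intro sets_borel_of_prod Polish_topology_second_countable)

lemma prob_measuresI: "prob_space \<mu> \<Longrightarrow> sets \<mu> = sets (borel_of S) \<Longrightarrow> \<mu> \<in> prob_measures S"
  by (simp add: prob_measures_def)

lemma prob_measuresD: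
  assumes "\<mu> \<in> prob_measures S"
  shows "prob_space \<mu>" "sets \<mu> = sets (borel_of S)" "space \<mu> = topspace S"
  using assms sets_eq_imp_space_eq[of \<mu> "borel_of S"] by (auto simp: prob_measures_def)

lemma couplingsD:
  assumes "\<gamma> \<in> couplings S T \<mu> \<nu>"
  shows "prob_space \<gamma>" "sets \<gamma> = sets (borel_of (prod_topology S T))"
    "space \<gamma> = topspace S \<times> topspace T"
    "distr \<gamma> (borel_of S) fst = \<mu>" "distr \<gamma> (borel_of T) snd = \<nu>"
  using assms prob_measuresD[of \<gamma> "prod_topology S T"] by (auto simp: couplings_def)

lemma state_input_measuresD:
  assumes "\<Lambda> \<in> state_input_measures S V \<mu>"
  shows "prob_space \<Lambda>" "sets \<Lambda> = sets (borel_of (prod_topology S V))"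
    "distr \<Lambda> (borel_of S) fst = \<mu>"
  using assms by (auto simp: state_input_measures_def prob_measures_def)

lemma distr_state_input_prob_measures:
  assumes "\<Lambda> \<in> state_input_measures S V \<mu>"
    and "f \<in> borel_of (prod_topology S V) \<rightarrow>\<^sub>M borel_of S'"
  shows "distr \<Lambda> (borel_of S') f \<in> prob_measures S'"
proof -
  have "f \<in> \<Lambda> \<rightarrow>\<^sub>M borel_of S'"
    using assms(2) measurable_cong_sets[OF state_input_measuresD(2)[OF assms(1)] refl] by blast
  then show ?thesis
    by (intro prob_measuresI prob_space.prob_space_distr state_input_measuresD(1)[OF assms(1)]) auto
qed

text \<open>The Borel version is taken for the image measure, so its exceptional null set pulls back
  to a null set of \<open>\<gamma>\<close> and the Borel change of variables applies.\<close>

lemma nn_integral_distr_lower_semianalytic: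
  assumes j: "lower_semianalytic M j" and "finite_measure \<gamma>" and m: "m \<in> \<gamma> \<rightarrow>\<^sub>M M"
  shows "(\<integral>\<^sup>+z. j z \<partial>distr \<gamma> M m) = (\<integral>\<^sup>+z. j (m z) \<partial>\<gamma>)"
proof -
  interpret finite_measure \<gamma> by fact
  obtain J where J: "J \<in> borel_measurable (distr \<gamma> M m)" "AE z in distr \<gamma> M m. j z = J z"
    using lower_semianalytic_version[OF j finite_measure_distr[OF m]] by auto
  have "(\<integral>\<^sup>+z. j z \<partial>distr \<gamma> M m) = (\<integral>\<^sup>+z. J z \<partial>distr \<gamma> M m)"
    by (rule nn_integral_cong_AE[OF J(2)])
  also have "\<dots> = (\<integral>\<^sup>+z. J (m z) \<partial>\<gamma>)" using J(1) by (intro nn_integral_distr[OF m]) simp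
  also have "\<dots> = (\<integral>\<^sup>+z. j (m z) \<partial>\<gamma>)"
    using AE_distrD[OF m J(2)] by (intro nn_integral_cong_AE) auto
  finally show ?thesis .
qed

text \<open>Additivity can fail for arbitrary nonnegative functions; passing to a Borel version of
  \<open>j\<close> restores it.\<close>

lemma nn_integral_add_lower_semianalytic:
  assumes j: "lower_semianalytic M j" and "finite_measure \<gamma>" and sets_\<gamma>: "sets \<gamma> = sets M"
    and c: "c \<in> borel_measurable M"
  shows "(\<integral>\<^sup>+z. c z + j z \<partial>\<gamma>) = (\<integral>\<^sup>+z. c z \<partial>\<gamma>) + (\<integral>\<^sup>+z. j z \<partial>\<gamma>)"
proof -
  obtain J where J: "J \<in> borel_measurable \<gamma>" "AE z in \<gamma>. j z = J z"
    using lower_semianalytic_version[OF assms(1-3)] by auto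
  have c': "c \<in> borel_measurable \<gamma>" using c measurable_cong_sets[OF sets_\<gamma> refl] by blast
  have "(\<integral>\<^sup>+z. c z + j z \<partial>\<gamma>) = (\<integral>\<^sup>+z. c z + J z \<partial>\<gamma>)"
    using J(2) by (intro nn_integral_cong_AE) auto
  also have "\<dots> = (\<integral>\<^sup>+z. c z \<partial>\<gamma>) + (\<integral>\<^sup>+z. J z \<partial>\<gamma>)" by (rule nn_integral_add[OF c' J(1)])
  also have "(\<integral>\<^sup>+z. J z \<partial>\<gamma>) = (\<integral>\<^sup>+z. j z \<partial>\<gamma>)"
    using J(2) by (intro nn_integral_cong_AE) auto
  finally show ?thesis .
qed

text \<open>The almost-everywhere hypothesis with a free error \<open>\<delta>\<close> serves two
  purposes: a selected map with arbitrarily small error, for the value identity, and a given map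
  with error \<open>\<epsilon>/2\<close>, possibly 0, for the optimality claim.\<close>

lemma transport_step_le:
  assumes Polish: "Polish_topology S" "Polish_topology V" "Polish_topology S'" "Polish_topology R"
    and f: "f \<in> borel_of (prod_topology S V) \<rightarrow>\<^sub>M borel_of S'"
    and g: "g \<in> borel_measurable (borel_of (prod_topology S V))"
    and j: "lower_semianalytic (borel_of (prod_topology S R)) j"
    and j': "lower_semianalytic (borel_of (prod_topology S' R)) j'"
    and \<gamma>: "\<gamma> \<in> couplings S R \<mu> \<rho>"
    and u: "u \<in> borel_of (prod_topology S R) \<rightarrow>\<^sub>M borel_of V"
    and le: "AE z in \<gamma>. g (fst z, u z) + j' (f (fst z, u z), snd z) \<le> j z + \<delta>"
  defines "\<Lambda> \<equiv> distr \<gamma> (borel_of (prod_topology S V)) (\<lambda>z. (fst z, u z))"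
  shows "\<Lambda> \<in> state_input_measures S V \<mu>"
    and "(\<integral>\<^sup>+z. g z \<partial>\<Lambda>) + ot_discrepancy S' R j' (distr \<Lambda> (borel_of S') f) \<rho> \<le> transport_cost j \<gamma> + \<delta>"
proof -
  note [measurable_cong] = couplingsD(2)[OF \<gamma>] sets_borel_of_prod_Polish[OF Polish(1,2)]
    sets_borel_of_prod_Polish[OF Polish(1,4)] sets_borel_of_prod_Polish[OF Polish(3,4)]
  note [measurable] = f g u
  interpret \<gamma>: prob_space \<gamma> using \<gamma> by (rule couplingsD)
  have l: "(\<lambda>z. (fst z, u z)) \<in> \<gamma> \<rightarrow>\<^sub>M borel_of (prod_topology S V)" by measurable
  define m where "m z = (f (fst z, u z), snd z)" for z
  have m: "m \<in> \<gamma> \<rightarrow>\<^sub>M borel_of (prod_topology S' R)" unfolding m_def by measurable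
  define \<gamma>' where "\<gamma>' = distr \<gamma> (borel_of (prod_topology S' R)) m"
  have "distr \<Lambda> (borel_of S) fst = distr \<gamma> (borel_of S) fst"
    unfolding \<Lambda>_def by (subst distr_distr[OF _ l]) (auto simp: comp_def)
  then have "distr \<Lambda> (borel_of S) fst = \<mu>" using couplingsD(4)[OF \<gamma>] by simp
  moreover have "prob_space \<Lambda>" unfolding \<Lambda>_def by (rule \<gamma>.prob_space_distr[OF l])
  ultimately show "\<Lambda> \<in> state_input_measures S V \<mu>"
    by (auto simp: state_input_measures_def prob_measures_def \<Lambda>_def)
  have "distr \<gamma>' (borel_of S') fst = distr \<gamma> (borel_of S') (\<lambda>z. f (fst z, u z))"
    unfolding \<gamma>'_def by (subst distr_distr[OF _ m]) (auto simp: comp_def m_def)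
  also have "\<dots> = distr \<Lambda> (borel_of S') f"
    unfolding \<Lambda>_def by (subst distr_distr[OF f l]) (simp add: comp_def)
  finally have "distr \<gamma>' (borel_of S') fst = distr \<Lambda> (borel_of S') f" .
  moreover have "distr \<gamma>' (borel_of R) snd = \<rho>"
    unfolding \<gamma>'_def couplingsD(5)[OF \<gamma>, symmetric]
    by (subst distr_distr[OF _ m]) (auto simp: comp_def m_def)
  moreover have "prob_space \<gamma>'" unfolding \<gamma>'_def by (rule \<gamma>.prob_space_distr[OF m])
  ultimately have "\<gamma>' \<in> couplings S' R (distr \<Lambda> (borel_of S') f) \<rho>"
    by (auto simp: couplings_def prob_measures_def \<gamma>'_def)
  then have "ot_discrepancy S' R j' (distr \<Lambda> (borel_of S') f) \<rho> \<le> transport_cost j' \<gamma>'"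
    unfolding ot_discrepancy_def by (rule INF_lower)
  also have "\<dots> = (\<integral>\<^sup>+z. j' (m z) \<partial>\<gamma>)"
    unfolding transport_cost_def nn_integral_completion \<gamma>'_def
    by (rule nn_integral_distr_lower_semianalytic[OF j' \<gamma>.finite_measure_axioms m])
  finally have "(\<integral>\<^sup>+z. g z \<partial>\<Lambda>) + ot_discrepancy S' R j' (distr \<Lambda> (borel_of S') f) \<rho>
      \<le> (\<integral>\<^sup>+z. g (fst z, u z) \<partial>\<gamma>) + (\<integral>\<^sup>+z. j' (m z) \<partial>\<gamma>)"
    unfolding \<Lambda>_def by (subst nn_integral_distr[OF l]) (auto intro!: add_mono)
  also have "\<dots> = (\<integral>\<^sup>+z. g (fst z, u z) + j' (m z) \<partial>\<gamma>)"
    by (rule nn_integral_add_lower_semianalytic[symmetric, of \<gamma>])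
       (auto intro: lower_semianalytic_compose[OF j' m] \<gamma>.finite_measure_axioms)
  \<comment> \<open>\<open>\<delta>\<close> stands first as the Borel summand of the additivity
    lemma; its integral is \<open>\<delta>\<close> because \<open>\<gamma>\<close> has mass
    1.\<close>
  also have "\<dots> \<le> (\<integral>\<^sup>+z. \<delta> + j z \<partial>\<gamma>)"
    using le by (intro nn_integral_mono_AE) (auto simp: m_def add.commute)
  also have "\<dots> = (\<integral>\<^sup>+z. \<delta> \<partial>\<gamma>) + (\<integral>\<^sup>+z. j z \<partial>\<gamma>)"
    by (rule nn_integral_add_lower_semianalytic[OF j \<gamma>.finite_measure_axioms couplingsD(2)[OF \<gamma>]]) simp
  also have "\<dots> = transport_cost j \<gamma> + \<delta>"
    by (simp add: transport_cost_def nn_integral_completion \<gamma>.emeasure_space_1 add.commute)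
  finally show "(\<integral>\<^sup>+z. g z \<partial>\<Lambda>) + ot_discrepancy S' R j' (distr \<Lambda> (borel_of S') f) \<rho>
      \<le> transport_cost j \<gamma> + \<delta>" .
qed

lemma transport_step_ge:
  assumes Polish: "Polish_topology S" "Polish_topology V" "Polish_topology S'" "Polish_topology R"
    and f: "f \<in> borel_of (prod_topology S V) \<rightarrow>\<^sub>M borel_of S'"
    and g: "g \<in> borel_measurable (borel_of (prod_topology S V))"
    and j: "lower_semianalytic (borel_of (prod_topology S R)) j"
    and j': "lower_semianalytic (borel_of (prod_topology S' R)) j'"
    and \<Lambda>: "\<Lambda> \<in> state_input_measures S V \<mu>"
    and le: "\<And>x u r. x \<in> topspace S \<Longrightarrow> u \<in> topspace V \<Longrightarrow> r \<in> topspace R \<Longrightarrow>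
      j (x, r) \<le> g (x, u) + j' (f (x, u), r)"
  shows "ot_discrepancy S R j \<mu> \<rho>
    \<le> (\<integral>\<^sup>+z. g z \<partial>\<Lambda>) + ot_discrepancy S' R j' (distr \<Lambda> (borel_of S') f) \<rho>"
  unfolding ot_discrepancy_def[of S'] INF_const_add_ennreal[symmetric]
proof (rule INF_greatest)
  fix \<gamma>' assume \<gamma>': "\<gamma>' \<in> couplings S' R (distr \<Lambda> (borel_of S') f) \<rho>"
  note sets_\<Lambda> = state_input_measuresD(2)[OF \<Lambda>]
  have sets_\<gamma>': "sets \<gamma>' = sets (borel_of S' \<Otimes>\<^sub>M borel_of R)"
    using couplingsD(2)[OF \<gamma>'] sets_borel_of_prod_Polish[OF Polish(3,4)] by simp
  note [measurable_cong] = sets_\<Lambda> sets_\<gamma>' sets_borel_of_prod_Polish[OF Polish(1,2)]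
    sets_borel_of_prod_Polish[OF Polish(1,4)] sets_borel_of_prod_Polish[OF Polish(3,4)]
  note [measurable] = f g
  have f': "f \<in> \<Lambda> \<rightarrow>\<^sub>M borel_of S'" by measurable
  obtain \<pi> where "prob_space \<pi>" and sets_\<pi>: "sets \<pi> = sets (\<Lambda> \<Otimes>\<^sub>M borel_of R)"
    and \<pi>_fst: "distr \<pi> \<Lambda> fst = \<Lambda>"
    and \<pi>_glue: "distr \<pi> (borel_of S' \<Otimes>\<^sub>M borel_of R) (\<lambda>z. (f (fst z), snd z)) = \<gamma>'"
    by (rule gluing[OF state_input_measuresD(1)[OF \<Lambda>] couplingsD(1)[OF \<gamma>'] sets_\<gamma>' f'
          couplingsD(4)[OF \<gamma>'] Polish(4)])
  interpret \<pi>: prob_space \<pi> by fact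
  note [measurable_cong] = sets_\<pi>
  have space_\<pi>: "space \<pi> = (topspace S \<times> topspace V) \<times> topspace R"
    using sets_eq_imp_space_eq[OF sets_\<pi>] sets_eq_imp_space_eq[OF sets_\<Lambda>] by (simp add: space_pair_measure)
  have fst_meas: "fst \<in> \<pi> \<rightarrow>\<^sub>M \<Lambda>" by measurable
  have m: "(\<lambda>z. (f (fst z), snd z)) \<in> \<pi> \<rightarrow>\<^sub>M borel_of S' \<Otimes>\<^sub>M borel_of R" by measurable
  have p: "(\<lambda>z. (fst (fst z), snd z)) \<in> \<pi> \<rightarrow>\<^sub>M borel_of (prod_topology S R)" by measurable
  \<comment> \<open>Forgetting the input leaves a plan whose first marginal comes from
    \<open>\<Lambda>\<close> and whose second comes from \<open>\<gamma>'\<close>.\<close>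
  define \<gamma> where "\<gamma> = distr \<pi> (borel_of (prod_topology S R)) (\<lambda>z. (fst (fst z), snd z))"
  have "distr \<gamma> (borel_of S) fst = distr \<pi> (borel_of S) (\<lambda>z. fst (fst z))"
    unfolding \<gamma>_def by (subst distr_distr[OF _ p]) (auto simp: comp_def)
  also have "\<dots> = distr (distr \<pi> \<Lambda> fst) (borel_of S) fst"
    by (subst distr_distr[OF _ fst_meas]) (auto simp: comp_def)
  also have "\<dots> = \<mu>" unfolding \<pi>_fst by (rule state_input_measuresD(3)[OF \<Lambda>])
  finally have "distr \<gamma> (borel_of S) fst = \<mu>" .
  moreover have "distr \<gamma> (borel_of R) snd = \<rho>"
  proof -
    have "distr \<gamma> (borel_of R) snd = distr \<pi> (borel_of R) snd"
      unfolding \<gamma>_def by (subst distr_distr[OF _ p]) (auto simp: comp_def)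
    also have "\<dots> = distr (distr \<pi> (borel_of S' \<Otimes>\<^sub>M borel_of R) (\<lambda>z. (f (fst z), snd z))) (borel_of R) snd"
      by (subst distr_distr[OF _ m]) (auto simp: comp_def)
    also have "\<dots> = \<rho>" unfolding \<pi>_glue by (rule couplingsD(5)[OF \<gamma>'])
    finally show ?thesis .
  qed
  moreover have "prob_space \<gamma>" unfolding \<gamma>_def by (rule \<pi>.prob_space_distr[OF p])
  ultimately have "\<gamma> \<in> couplings S R \<mu> \<rho>"
    by (auto simp: couplings_def prob_measures_def \<gamma>_def)
  then have "ot_discrepancy S R j \<mu> \<rho> \<le> transport_cost j \<gamma>"
    unfolding ot_discrepancy_def by (rule INF_lower)
  also have "\<dots> = (\<integral>\<^sup>+z. j (fst (fst z), snd z) \<partial>\<pi>)"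
    unfolding transport_cost_def nn_integral_completion \<gamma>_def
    by (rule nn_integral_distr_lower_semianalytic[OF j \<pi>.finite_measure_axioms p])
  also have "\<dots> \<le> (\<integral>\<^sup>+z. g (fst z) + j' (f (fst z), snd z) \<partial>\<pi>)"
    by (rule nn_integral_mono) (use le in \<open>auto simp: space_\<pi>\<close>)
  also have "\<dots> = (\<integral>\<^sup>+z. g (fst z) \<partial>\<pi>) + (\<integral>\<^sup>+z. j' (f (fst z), snd z) \<partial>\<pi>)"
  proof (rule nn_integral_add_lower_semianalytic[of \<pi>])
    show "lower_semianalytic \<pi> (\<lambda>z. j' (f (fst z), snd z))"
      by (rule lower_semianalytic_compose[OF j']) measurable
  qed (auto intro: \<pi>.finite_measure_axioms)
  also have "(\<integral>\<^sup>+z. g (fst z) \<partial>\<pi>) = (\<integral>\<^sup>+z. g z \<partial>distr \<pi> \<Lambda> fst)"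
    by (rule nn_integral_distr[OF fst_meas, symmetric]) measurable
  also have "\<dots> = (\<integral>\<^sup>+z. g z \<partial>\<Lambda>)" by (simp add: \<pi>_fst)
  also have "(\<integral>\<^sup>+z. j' (f (fst z), snd z) \<partial>\<pi>)
      = (\<integral>\<^sup>+z. j' z \<partial>distr \<pi> (borel_of (prod_topology S' R)) (\<lambda>z. (f (fst z), snd z)))"
    by (rule nn_integral_distr_lower_semianalytic[OF j' \<pi>.finite_measure_axioms, symmetric]) measurable
  also have "distr \<pi> (borel_of (prod_topology S' R)) (\<lambda>z. (f (fst z), snd z)) = \<gamma>'"
    unfolding \<pi>_glue[symmetric] by (rule distr_cong) (auto simp: sets_borel_of_prod_Polish[OF Polish(3,4)])
  finally show "ot_discrepancy S R j \<mu> \<rho> \<le> (\<integral>\<^sup>+z. g z \<partial>\<Lambda>) + transport_cost j' \<gamma>'"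
    by (simp add: transport_cost_def nn_integral_completion)
qed

subsection \<open>Dynamic programming\<close>

lemma ground_cost_to_go_step:
  "k < N \<Longrightarrow> ground_cost_to_go N U f g gN k z =
    (INF u\<in>topspace (U k). g k (fst z, u) + ground_cost_to_go N U f g gN (Suc k) (f k (fst z, u), snd z))"
  by (cases z) (simp add: ground_cost_to_go.simps[of N U f g gN k])

lemma ground_cost_to_go_final: "ground_cost_to_go N U f g gN N = gN"
  by (rule ext) (auto simp: ground_cost_to_go.simps)

text \<open>Stability and selection share the integrand \<open>?b\<close> of one step, a Borel cost
  plus the next cost-to-go composed with the dynamics.\<close>

lemma lower_semianalytic_ground_cost_to_go:
  fixes X :: "nat \<Rightarrow> 'x topology" and U :: "nat \<Rightarrow> 'u topology" and RN :: "'r topology"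
  assumes X: "\<And>k. k \<le> N \<Longrightarrow> Polish_topology (X k)"
    and U: "\<And>k. k < N \<Longrightarrow> Polish_topology (U k)"
    and RN: "Polish_topology RN"
    and f: "\<And>k. k < N \<Longrightarrow> f k \<in> borel_of (prod_topology (X k) (U k)) \<rightarrow>\<^sub>M borel_of (X (Suc k))"
    and g: "\<And>k. k < N \<Longrightarrow> g k \<in> borel_measurable (borel_of (prod_topology (X k) (U k)))"
    and gN: "gN \<in> borel_measurable (borel_of (prod_topology (X N) RN))"
  shows lower_semianalytic_ground: "k \<le> N \<Longrightarrow>
      lower_semianalytic (borel_of (prod_topology (X k) RN)) (ground_cost_to_go N U f g gN k)"
    and ground_eps_selection: "k < N \<Longrightarrow> topspace (U k) \<noteq> {} \<Longrightarrow> finite_measure \<gamma> \<Longrightarrow>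
      sets \<gamma> = sets (borel_of (prod_topology (X k) RN)) \<Longrightarrow> (\<epsilon>::real) > 0 \<Longrightarrow>
      \<exists>u \<in> borel_of (prod_topology (X k) RN) \<rightarrow>\<^sub>M borel_of (U k). AE z in \<gamma>.
        g k (fst z, u z) + ground_cost_to_go N U f g gN (Suc k) (f k (fst z, u z), snd z)
          \<le> ground_cost_to_go N U f g gN k z + ennreal \<epsilon>"
proof -
  let ?j = "ground_cost_to_go N U f g gN" and ?M = "\<lambda>k. borel_of (prod_topology (X k) RN)"
  let ?b = "\<lambda>k y. g k (fst (fst y), snd y) + ?j (Suc k) (f k (fst (fst y), snd y), snd (fst y))"
  have b: "lower_semianalytic (?M k \<Otimes>\<^sub>M borel_of (U k)) (?b k)"
    if k: "k < N" and IH: "lower_semianalytic (?M (Suc k)) (?j (Suc k))" for k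
  proof (rule lower_semianalytic_add)
    note [measurable_cong] = sets_borel_of_prod_Polish[OF X U, OF less_imp_le[OF k] k]
      sets_borel_of_prod_Polish[OF X RN, OF less_imp_le[OF k]]
      sets_borel_of_prod_Polish[OF X RN, OF Suc_leI[OF k]]
    note [measurable] = f[OF k] g[OF k]
    show "lower_semianalytic (?M k \<Otimes>\<^sub>M borel_of (U k))
        (\<lambda>y. ?j (Suc k) (f k (fst (fst y), snd y), snd (fst y)))"
      by (rule lower_semianalytic_compose[OF IH]) measurable
    show "(\<lambda>y. g k (fst (fst y), snd y)) \<in> borel_measurable (?M k \<Otimes>\<^sub>M borel_of (U k))"
      by measurable
  qed
  have step: "?j k = (\<lambda>z. INF u\<in>space (borel_of (U k)). ?b k (z, u))" if "k < N" for k
    using that by (auto simp: ground_cost_to_go_step)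
  show lsa: "lower_semianalytic (?M k) (?j k)" if "k \<le> N" for k
    using that
  proof (induction rule: inc_induct)
    case base
    then show ?case by (simp add: ground_cost_to_go_final lower_semianalytic_measurable[OF gN])
  next
    case (step k)
    show ?case
    proof (cases "topspace (U k) = {}")
      case True
      then have "?j k = (\<lambda>z. top)" using step(2) by (auto simp: ground_cost_to_go_step)
      then show ?thesis by (simp add: lower_semianalytic_measurable)
    next
      case False
      obtain \<phi> where "\<phi> \<in> baire \<rightarrow>\<^sub>M borel_of (U k)" "range \<phi> = topspace (U k)"
        using Polish_topology_baire_surjection[OF U False] step(2) by blast
      then show ?thesis
        unfolding \<open>k < N \<Longrightarrow> ?j k = _\<close>[OF step(2)]
        by (intro lower_semianalytic_INF[OF b[OF step(2,3)]]) auto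
    qed
  qed
  assume k: "k < N" and ne: "topspace (U k) \<noteq> {}" and \<gamma>: "finite_measure \<gamma>" "sets \<gamma> = sets (?M k)" "\<epsilon> > 0"
  obtain \<phi> where \<phi>: "\<phi> \<in> baire \<rightarrow>\<^sub>M borel_of (U k)" "range \<phi> = topspace (U k)"
    using Polish_topology_baire_surjection[OF U ne] k by blast
  show "\<exists>u\<in>?M k \<rightarrow>\<^sub>M borel_of (U k). AE z in \<gamma>.
        g k (fst z, u z) + ?j (Suc k) (f k (fst z, u z), snd z) \<le> ?j k z + ennreal \<epsilon>"
    using lower_semianalytic_eps_selection[OF b[OF k lsa] _ _ \<gamma>, of \<phi>] \<phi> k step[OF k] by simp
qed

lemma prob_cost_to_go_eq_ot_discrepancy:
  fixes X :: "nat \<Rightarrow> 'x topology" and U :: "nat \<Rightarrow> 'u topology" and RN :: "'r topology"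
  assumes X: "\<And>k. k \<le> N \<Longrightarrow> Polish_topology (X k)"
    and U: "\<And>k. k < N \<Longrightarrow> Polish_topology (U k)"
    and RN: "Polish_topology RN"
    and f: "\<And>k. k < N \<Longrightarrow> f k \<in> borel_of (prod_topology (X k) (U k)) \<rightarrow>\<^sub>M borel_of (X (Suc k))"
    and g: "\<And>k. k < N \<Longrightarrow> g k \<in> borel_measurable (borel_of (prod_topology (X k) (U k)))"
    and gN: "gN \<in> borel_measurable (borel_of (prod_topology (X N) RN))"
    and "k \<le> N"
  shows "prob_cost_to_go N X U RN f g gN k \<mu> \<rho> =
    ot_discrepancy (X k) RN (ground_cost_to_go N U f g gN k) \<mu> \<rho>"
  using \<open>k \<le> N\<close>
proof (induction arbitrary: \<mu> rule: inc_induct)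
  case base
  then show ?case by (simp add: prob_cost_to_go.simps ground_cost_to_go_final)
next
  case (step k)
  let ?j = "ground_cost_to_go N U f g gN"
  let ?S = "state_input_measures (X k) (U k) \<mu>"
  let ?cost = "\<lambda>\<Lambda>. (\<integral>\<^sup>+ z. g k z \<partial>\<Lambda>) +
    ot_discrepancy (X (Suc k)) RN (?j (Suc k)) (distr \<Lambda> (borel_of (X (Suc k))) (f k)) \<rho>"
  have k: "k < N" "k \<le> N" "Suc k \<le> N" using step(2) by auto
  have lsa: "lower_semianalytic (borel_of (prod_topology (X i) RN)) (?j i)" if "i \<le> N" for i
    by (rule lower_semianalytic_ground[OF X U RN f g gN that])
  note Polish = X[OF k(2)] U[OF k(1)] X[OF k(3)] RN
  have prob: "prob_cost_to_go N X U RN f g gN k \<mu> \<rho> = (INF \<Lambda>\<in>?S. ?cost \<Lambda>)"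
    using k(1) by (subst prob_cost_to_go.simps) (simp add: step.IH)
  show ?case
    unfolding prob
  proof (rule antisym)
    show "ot_discrepancy (X k) RN (?j k) \<mu> \<rho> \<le> (INF \<Lambda>\<in>?S. ?cost \<Lambda>)"
    proof (rule INF_greatest)
      fix \<Lambda> assume \<Lambda>: "\<Lambda> \<in> ?S"
      show "ot_discrepancy (X k) RN (?j k) \<mu> \<rho> \<le> ?cost \<Lambda>"
      proof (rule transport_step_ge[OF Polish f[OF k(1)] g[OF k(1)] lsa[OF k(2)] lsa[OF k(3)] \<Lambda>])
        fix x u r assume "u \<in> topspace (U k)"
        then show "?j k (x, r) \<le> g k (x, u) + ?j (Suc k) (f k (x, u), r)"
          unfolding ground_cost_to_go_step[OF k(1)] by (intro INF_lower2[of u]) auto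
      qed
    qed
    show "(INF \<Lambda>\<in>?S. ?cost \<Lambda>) \<le> ot_discrepancy (X k) RN (?j k) \<mu> \<rho>"
      unfolding ot_discrepancy_def[of "X k"]
    proof (rule INF_greatest)
      fix \<gamma> assume \<gamma>: "\<gamma> \<in> couplings (X k) RN \<mu> \<rho>"
      interpret \<gamma>: prob_space \<gamma> using \<gamma> by (rule couplingsD)
      show "(INF \<Lambda>\<in>?S. ?cost \<Lambda>) \<le> transport_cost (?j k) \<gamma>"
      proof (cases "topspace (U k) = {}")
        case True
        then have "?j k = (\<lambda>z. top)" using k(1) by (auto simp: ground_cost_to_go_step)
        then show ?thesis
          by (simp add: transport_cost_def nn_integral_completion \<gamma>.emeasure_space_1)
      next
        case False
        show ?thesis
        proof (rule ennreal_le_epsilon)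
          fix \<epsilon> :: real assume "\<epsilon> > 0"
          then obtain u where u: "u \<in> borel_of (prod_topology (X k) RN) \<rightarrow>\<^sub>M borel_of (U k)"
            "AE z in \<gamma>. g k (fst z, u z) + ?j (Suc k) (f k (fst z, u z), snd z) \<le> ?j k z + ennreal \<epsilon>"
            using ground_eps_selection[OF X U RN f g gN k(1) False \<gamma>.finite_measure_axioms couplingsD(2)[OF \<gamma>]]
            by blast
          note transport_step_le[OF Polish f[OF k(1)] g[OF k(1)] lsa[OF k(2)] lsa[OF k(3)] \<gamma> u]
          then show "(INF \<Lambda>\<in>?S. ?cost \<Lambda>) \<le> transport_cost (?j k) \<gamma> + ennreal \<epsilon>"
            by (rule INF_lower2)
        qed
      qed
    qed
  qed
qed

lemma prob_cost_to_go_le_admissible: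
  assumes "admissible N X U f \<mu> \<mu>s \<Lambda>s" "k \<le> N"
  shows "prob_cost_to_go N X U RN f g gN k (\<mu>s k) \<rho> \<le>
    ot_discrepancy (X N) RN gN (\<mu>s N) \<rho> + (\<Sum>i\<in>{k..<N}. \<integral>\<^sup>+ z. g i z \<partial>\<Lambda>s i)"
  using assms(2)
proof (induction rule: inc_induct)
  case base
  then show ?case by (simp add: prob_cost_to_go.simps)
next
  case (step k)
  let ?J = "prob_cost_to_go N X U RN f g gN"
  have "\<Lambda>s k \<in> state_input_measures (X k) (U k) (\<mu>s k)"
    "\<mu>s (Suc k) = distr (\<Lambda>s k) (borel_of (X (Suc k))) (f k)"
    using assms(1) step(2) by (auto simp: admissible_def)
  then have "?J k (\<mu>s k) \<rho> \<le> (\<integral>\<^sup>+ z. g k z \<partial>\<Lambda>s k) + ?J (Suc k) (\<mu>s (Suc k)) \<rho>"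
    using step(2) by (subst prob_cost_to_go.simps) (auto intro: INF_lower2)
  also have "\<dots> \<le> (\<integral>\<^sup>+ z. g k z \<partial>\<Lambda>s k) +
      (ot_discrepancy (X N) RN gN (\<mu>s N) \<rho> + (\<Sum>i\<in>{Suc k..<N}. \<integral>\<^sup>+ z. g i z \<partial>\<Lambda>s i))"
    by (intro add_left_mono step.IH)
  also have "\<dots> = ot_discrepancy (X N) RN gN (\<mu>s N) \<rho> + (\<Sum>i\<in>{k..<N}. \<integral>\<^sup>+ z. g i z \<partial>\<Lambda>s i)"
    using step(2) by (simp add: sum.atLeast_Suc_lessThan ac_simps)
  finally show ?case .
qed

lemma prob_cost_to_go_less_imp_sequence:
  assumes f: "\<And>k. k < N \<Longrightarrow> f k \<in> borel_of (prod_topology (X k) (U k)) \<rightarrow>\<^sub>M borel_of (X (Suc k))"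
    and "k \<le> N" "\<mu> \<in> prob_measures (X k)" "prob_cost_to_go N X U RN f g gN k \<mu> \<rho> < c"
  shows "\<exists>\<mu>s \<Lambda>s. \<mu>s k = \<mu> \<and> (\<forall>i\<in>{k..N}. \<mu>s i \<in> prob_measures (X i)) \<and>
    (\<forall>i\<in>{k..<N}. \<Lambda>s i \<in> state_input_measures (X i) (U i) (\<mu>s i) \<and>
       \<mu>s (Suc i) = distr (\<Lambda>s i) (borel_of (X (Suc i))) (f i)) \<and>
    ot_discrepancy (X N) RN gN (\<mu>s N) \<rho> + (\<Sum>i\<in>{k..<N}. \<integral>\<^sup>+ z. g i z \<partial>\<Lambda>s i) < c"
  using assms(2-)
proof (induction arbitrary: \<mu> c rule: inc_induct)
  case base
  then show ?case by (intro exI[of _ "\<lambda>_. \<mu>"]) (simp add: prob_cost_to_go.simps)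
next
  case (step k)
  let ?J = "prob_cost_to_go N X U RN f g gN"
  obtain \<Lambda> where \<Lambda>: "\<Lambda> \<in> state_input_measures (X k) (U k) \<mu>"
    and less: "(\<integral>\<^sup>+ z. g k z \<partial>\<Lambda>) + ?J (Suc k) (distr \<Lambda> (borel_of (X (Suc k))) (f k)) \<rho> < c"
    using step.prems(2) step(2) by (subst (asm) prob_cost_to_go.simps) (auto simp: INF_less_iff)
  define a where "a = (\<integral>\<^sup>+ z. g k z \<partial>\<Lambda>)"
  define \<mu>' where "\<mu>' = distr \<Lambda> (borel_of (X (Suc k))) (f k)"
  have "a \<le> a + ?J (Suc k) \<mu>' \<rho>" by simp
  also have "\<dots> \<le> c" using less by (simp add: a_def \<mu>'_def less_imp_le)
  finally have "a \<le> c" .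
  then have ac: "a + (c - a) = c" by (rule add_diff_inverse_ennreal)
  have "?J (Suc k) \<mu>' \<rho> < c - a"
  proof (rule ccontr)
    assume "\<not> ?J (Suc k) \<mu>' \<rho> < c - a"
    then have "a + (c - a) \<le> a + ?J (Suc k) \<mu>' \<rho>" by (intro add_left_mono) simp
    then have "c \<le> a + ?J (Suc k) \<mu>' \<rho>" unfolding ac .
    then show False using less unfolding a_def \<mu>'_def by order
  qed
  moreover have "\<mu>' \<in> prob_measures (X (Suc k))"
    unfolding \<mu>'_def by (rule distr_state_input_prob_measures[OF \<Lambda> f[OF step(2)]])
  ultimately obtain \<mu>s \<Lambda>s where seq: "\<mu>s (Suc k) = \<mu>'" "\<forall>i\<in>{Suc k..N}. \<mu>s i \<in> prob_measures (X i)"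
    "\<forall>i\<in>{Suc k..<N}. \<Lambda>s i \<in> state_input_measures (X i) (U i) (\<mu>s i) \<and>
       \<mu>s (Suc i) = distr (\<Lambda>s i) (borel_of (X (Suc i))) (f i)"
    "ot_discrepancy (X N) RN gN (\<mu>s N) \<rho> + (\<Sum>i\<in>{Suc k..<N}. \<integral>\<^sup>+ z. g i z \<partial>\<Lambda>s i) < c - a"
    using step.IH by blast
  have "a \<noteq> top" using less by (auto simp: a_def)
  have "a + (ot_discrepancy (X N) RN gN (\<mu>s N) \<rho> + (\<Sum>i\<in>{Suc k..<N}. \<integral>\<^sup>+ z. g i z \<partial>\<Lambda>s i)) < a + (c - a)"
    unfolding ennreal_add_left_cancel_less using seq(4) \<open>a \<noteq> top\<close> by simp
  then have "a + (ot_discrepancy (X N) RN gN (\<mu>s N) \<rho> + (\<Sum>i\<in>{Suc k..<N}. \<integral>\<^sup>+ z. g i z \<partial>\<Lambda>s i)) < c"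
    unfolding ac .
  moreover have "(\<Sum>i\<in>{k..<N}. \<integral>\<^sup>+ z. g i z \<partial>(\<Lambda>s(k := \<Lambda>)) i)
      = a + (\<Sum>i\<in>{Suc k..<N}. \<integral>\<^sup>+ z. g i z \<partial>\<Lambda>s i)"
    using step(2) by (simp add: sum.atLeast_Suc_lessThan a_def)
  ultimately have "ot_discrepancy (X N) RN gN ((\<mu>s(k := \<mu>)) N) \<rho> +
      (\<Sum>i\<in>{k..<N}. \<integral>\<^sup>+ z. g i z \<partial>(\<Lambda>s(k := \<Lambda>)) i) < c"
    using step(2) by (simp add: ac_simps)
  moreover have "\<forall>i\<in>{k..N}. (\<mu>s(k := \<mu>)) i \<in> prob_measures (X i)"
    using seq(2) step.prems(1) by auto
  moreover have "\<forall>i\<in>{k..<N}. (\<Lambda>s(k := \<Lambda>)) i \<in> state_input_measures (X i) (U i) ((\<mu>s(k := \<mu>)) i) \<and>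
      (\<mu>s(k := \<mu>)) (Suc i) = distr ((\<Lambda>s(k := \<Lambda>)) i) (borel_of (X (Suc i))) (f i)"
    using seq(1,3) \<Lambda> by (auto simp: \<mu>'_def)
  ultimately show ?case by (intro exI[of _ "\<mu>s(k := \<mu>)"] exI[of _ "\<Lambda>s(k := \<Lambda>)"]) simp
qed

lemma control_value_eq_prob_cost_to_go:
  assumes f: "\<And>k. k < N \<Longrightarrow> f k \<in> borel_of (prod_topology (X k) (U k)) \<rightarrow>\<^sub>M borel_of (X (Suc k))"
    and \<mu>: "\<mu> \<in> prob_measures (X 0)"
  shows "control_value N X U RN f g gN \<mu> \<rho> = prob_cost_to_go N X U RN f g gN 0 \<mu> \<rho>"
proof (rule antisym)
  show "prob_cost_to_go N X U RN f g gN 0 \<mu> \<rho> \<le> control_value N X U RN f g gN \<mu> \<rho>"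
    unfolding control_value_def
  proof (rule INF_greatest, safe)
    fix \<mu>s \<Lambda>s assume a: "admissible N X U f \<mu> \<mu>s \<Lambda>s"
    then have "\<mu>s 0 = \<mu>" by (simp add: admissible_def)
    then show "prob_cost_to_go N X U RN f g gN 0 \<mu> \<rho>
        \<le> ot_discrepancy (X N) RN gN (\<mu>s N) \<rho> + (\<Sum>k<N. \<integral>\<^sup>+ z. g k z \<partial>\<Lambda>s k)"
      using prob_cost_to_go_le_admissible[OF a, of 0] by (simp add: lessThan_atLeast0)
  qed
  show "control_value N X U RN f g gN \<mu> \<rho> \<le> prob_cost_to_go N X U RN f g gN 0 \<mu> \<rho>"
  proof (rule leI, rule notI)
    assume "prob_cost_to_go N X U RN f g gN 0 \<mu> \<rho> < control_value N X U RN f g gN \<mu> \<rho>"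
    from prob_cost_to_go_less_imp_sequence[of N f X U, OF f _ \<mu> this] obtain \<mu>s \<Lambda>s where
      seq: "\<mu>s 0 = \<mu>" "\<forall>i\<in>{0..N}. \<mu>s i \<in> prob_measures (X i)"
      "\<forall>i\<in>{0..<N}. \<Lambda>s i \<in> state_input_measures (X i) (U i) (\<mu>s i) \<and>
         \<mu>s (Suc i) = distr (\<Lambda>s i) (borel_of (X (Suc i))) (f i)"
      and less: "ot_discrepancy (X N) RN gN (\<mu>s N) \<rho> + (\<Sum>i\<in>{0..<N}. \<integral>\<^sup>+ z. g i z \<partial>\<Lambda>s i)
        < control_value N X U RN f g gN \<mu> \<rho>"
      by auto
    have "admissible N X U f \<mu> \<mu>s \<Lambda>s" using seq by (auto simp: admissible_def)
    then have "control_value N X U RN f g gN \<mu> \<rho> \<le>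
        ot_discrepancy (X N) RN gN (\<mu>s N) \<rho> + (\<Sum>i<N. \<integral>\<^sup>+ z. g i z \<partial>\<Lambda>s i)"
      unfolding control_value_def by (intro INF_lower2[of "(\<mu>s, \<Lambda>s)"]) auto
    with less show False by (simp add: lessThan_atLeast0)
  qed
qed

theorem corollary4p2:
  fixes N :: nat
    and X :: "nat \<Rightarrow> 'x topology" and U :: "nat \<Rightarrow> 'u topology" and R :: "nat \<Rightarrow> 'r topology"
    and f :: "nat \<Rightarrow> 'x \<times> 'u \<Rightarrow> 'x" and g :: "nat \<Rightarrow> 'x \<times> 'u \<Rightarrow> ennreal"
    and gN :: "'x \<times> 'r \<Rightarrow> ennreal"
  assumes "N \<ge> 1"
    and "\<And>k. k \<le> N \<Longrightarrow> Polish_topology (X k)"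
    and "\<And>k. k < N \<Longrightarrow> Polish_topology (U k)"
    and "\<And>k. k \<le> N \<Longrightarrow> Polish_topology (R k)"
    and "\<And>k. k < N \<Longrightarrow>
           f k \<in> borel_of (prod_topology (X k) (U k)) \<rightarrow>\<^sub>M borel_of (X (Suc k))"
    and "\<And>k. k < N \<Longrightarrow> g k \<in> borel_measurable (borel_of (prod_topology (X k) (U k)))"
    and "gN \<in> borel_measurable (borel_of (prod_topology (X N) (R N)))"
  shows
    "(\<forall>k\<le>N. \<forall>\<mu> \<in> prob_measures (X k). \<forall>\<rho> \<in> prob_measures (R N).
        prob_cost_to_go N X U (R N) f g gN k \<mu> \<rho> =
        ot_discrepancy (X k) (R N) (ground_cost_to_go N U f g gN k) \<mu> \<rho>) \<and>
     (\<forall>\<mu> \<in> prob_measures (X 0). \<forall>\<rho> \<in> prob_measures (R N).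
        control_value N X U (R N) f g gN \<mu> \<rho> = prob_cost_to_go N X U (R N) f g gN 0 \<mu> \<rho>) \<and>
     (\<forall>k<N. \<forall>\<mu> \<in> prob_measures (X k). \<forall>\<rho> \<in> prob_measures (R N). \<forall>\<epsilon>::real. \<forall>u \<gamma>.
        \<epsilon> \<ge> 0 \<longrightarrow>
        u \<in> borel_of (prod_topology (X k) (R N)) \<rightarrow>\<^sub>M borel_of (U k) \<longrightarrow>
        eps_optimal_input_map N X U (R N) f g gN k (\<epsilon> / 2) u \<longrightarrow>
        eps_optimal_plan (X k) (R N) (ground_cost_to_go N U f g gN k) \<mu> \<rho> (\<epsilon> / 2) \<gamma> \<longrightarrow>
        (let \<Lambda> = distr \<gamma> (borel_of (prod_topology (X k) (U k))) (\<lambda>z. (fst z, u z)) in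
           eps_optimal_state_input N X U (R N) f g gN k \<mu> \<rho> \<epsilon> \<Lambda> \<and>
           (\<epsilon> = 0 \<longrightarrow> optimal_state_input N X U (R N) f g gN k \<mu> \<rho> \<Lambda>) \<and>
           (\<forall>T \<in> borel_of (X k) \<rightarrow>\<^sub>M borel_of (R N).
              \<gamma> = distr \<mu> (borel_of (prod_topology (X k) (R N))) (\<lambda>x. (x, T x)) \<longrightarrow>
              \<Lambda> = distr \<mu> (borel_of (prod_topology (X k) (U k))) (\<lambda>x. (x, u (x, T x))))))"
proof -
  note X = assms(2) and U = assms(3) and RN = assms(4)[OF order_refl]
    and f = assms(5) and g = assms(6) and gN = assms(7)
  have value_eq: "prob_cost_to_go N X U (R N) f g gN k \<mu> \<rho> =
      ot_discrepancy (X k) (R N) (ground_cost_to_go N U f g gN k) \<mu> \<rho>" if "k \<le> N" for k \<mu> \<rho>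
    by (rule prob_cost_to_go_eq_ot_discrepancy[OF X U RN f g gN that])
  have lsa: "lower_semianalytic (borel_of (prod_topology (X k) (R N))) (ground_cost_to_go N U f g gN k)"
    if "k \<le> N" for k
    by (rule lower_semianalytic_ground[OF X U RN f g gN that])
  show ?thesis
  proof (intro conjI allI ballI impI)
    show "prob_cost_to_go N X U (R N) f g gN k \<mu> \<rho> =
        ot_discrepancy (X k) (R N) (ground_cost_to_go N U f g gN k) \<mu> \<rho>" if "k \<le> N" for k \<mu> \<rho>
      by (rule value_eq[OF that])
    show "control_value N X U (R N) f g gN \<mu> \<rho> = prob_cost_to_go N X U (R N) f g gN 0 \<mu> \<rho>"
      if "\<mu> \<in> prob_measures (X 0)" for \<mu> \<rho>
      by (rule control_value_eq_prob_cost_to_go[OF f that])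
  next
    fix k \<mu> \<rho> u \<gamma> and \<epsilon> :: real
    let ?j = "ground_cost_to_go N U f g gN" and ?J = "prob_cost_to_go N X U (R N) f g gN"
    assume k: "k < N" and \<mu>: "\<mu> \<in> prob_measures (X k)" and "\<epsilon> \<ge> 0"
      and u: "u \<in> borel_of (prod_topology (X k) (R N)) \<rightarrow>\<^sub>M borel_of (U k)"
      and u_opt: "eps_optimal_input_map N X U (R N) f g gN k (\<epsilon> / 2) u"
      and \<gamma>_opt: "eps_optimal_plan (X k) (R N) (?j k) \<mu> \<rho> (\<epsilon> / 2) \<gamma>"
    have k': "k \<le> N" "Suc k \<le> N" using k by auto
    have \<gamma>: "\<gamma> \<in> couplings (X k) (R N) \<mu> \<rho>"
      and \<gamma>_le: "transport_cost (?j k) \<gamma> \<le> ot_discrepancy (X k) (R N) (?j k) \<mu> \<rho> + ennreal (\<epsilon> / 2)"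
      using \<gamma>_opt by (auto simp: eps_optimal_plan_def)
    define \<Lambda> where "\<Lambda> = distr \<gamma> (borel_of (prod_topology (X k) (U k))) (\<lambda>z. (fst z, u z))"
    have "AE z in \<gamma>. g k (fst z, u z) + ?j (Suc k) (f k (fst z, u z), snd z) \<le> ?j k z + ennreal (\<epsilon> / 2)"
      using u_opt by (intro AE_I2) (auto simp: eps_optimal_input_map_def couplingsD(3)[OF \<gamma>])
    note step = transport_step_le[OF X[OF k'(1)] U[OF k] X[OF k'(2)] RN f[OF k] g[OF k]
        lsa[OF k'(1)] lsa[OF k'(2)]
        \<gamma> u this, folded \<Lambda>_def]
    have "(\<integral>\<^sup>+ z. g k z \<partial>\<Lambda>) + ?J (Suc k) (distr \<Lambda> (borel_of (X (Suc k))) (f k)) \<rho>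
        \<le> transport_cost (?j k) \<gamma> + ennreal (\<epsilon> / 2)"
      using step(2) by (simp add: value_eq[OF k'(2)])
    also have "\<dots> \<le> ot_discrepancy (X k) (R N) (?j k) \<mu> \<rho> + ennreal (\<epsilon> / 2) + ennreal (\<epsilon> / 2)"
      by (intro add_right_mono \<gamma>_le)
    also have "\<dots> = ?J k \<mu> \<rho> + ennreal \<epsilon>"
      using \<open>\<epsilon> \<ge> 0\<close> by (simp add: value_eq[OF k'(1)] add.assoc flip: ennreal_plus)
    finally have opt: "eps_optimal_state_input N X U (R N) f g gN k \<mu> \<rho> \<epsilon> \<Lambda>"
      using step(1) by (simp add: eps_optimal_state_input_def)
    have "\<Lambda> = distr \<mu> (borel_of (prod_topology (X k) (U k))) (\<lambda>x. (x, u (x, T x)))"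
      if T: "T \<in> borel_of (X k) \<rightarrow>\<^sub>M borel_of (R N)"
        and \<gamma>_T: "\<gamma> = distr \<mu> (borel_of (prod_topology (X k) (R N))) (\<lambda>x. (x, T x))" for T
    proof -
      note [measurable_cong] = prob_measuresD(2)[OF \<mu>] sets_borel_of_prod_Polish[OF X[OF k'(1)] U[OF k]]
        sets_borel_of_prod_Polish[OF X[OF k'(1)] RN]
      note [measurable] = T u
      have "(\<lambda>z. (fst z, u z)) \<in> borel_of (prod_topology (X k) (R N)) \<rightarrow>\<^sub>M borel_of (prod_topology (X k) (U k))"
        by measurable
      moreover have "(\<lambda>x. (x, T x)) \<in> \<mu> \<rightarrow>\<^sub>M borel_of (prod_topology (X k) (R N))"
        by measurable
      ultimately show ?thesis
        unfolding \<Lambda>_def \<gamma>_T by (subst distr_distr) (auto simp: comp_def)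
    qed
    then show "let \<Lambda> = distr \<gamma> (borel_of (prod_topology (X k) (U k))) (\<lambda>z. (fst z, u z)) in
           eps_optimal_state_input N X U (R N) f g gN k \<mu> \<rho> \<epsilon> \<Lambda> \<and>
           (\<epsilon> = 0 \<longrightarrow> optimal_state_input N X U (R N) f g gN k \<mu> \<rho> \<Lambda>) \<and>
           (\<forall>T \<in> borel_of (X k) \<rightarrow>\<^sub>M borel_of (R N).
              \<gamma> = distr \<mu> (borel_of (prod_topology (X k) (R N))) (\<lambda>x. (x, T x)) \<longrightarrow>
              \<Lambda> = distr \<mu> (borel_of (prod_topology (X k) (U k))) (\<lambda>x. (x, u (x, T x))))"
      unfolding Let_def optimal_state_input_def \<Lambda>_def[symmetric] using opt by blast
  qed
qed

end
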